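(* Consider either the Hedge setting or the OCO setting described in the context, with the learner satisfying the second-order guarantee (G) with positive deterministic numbers $K_T$. Let $\epsilon(\eta)$ be the maximal normalized cumulant generating function of the excess loss family. Then for every $T\ge1$ and every $\gamma>0$, with $c=\frac{1}{1+\sqrt{1+4\gamma^2}}$, \[ R_T^{f^*}\;\trianglelefteq_\gamma\;\frac{K_T}{c\gamma}+T\,\epsilon(2\gamma)\,(1+c\gamma^2)+2K_T, \] i.e. $\mathbb E\Big[\exp\Big(\gamma\big(R_T^{f^*}-\tfrac{K_T}{c\gamma}-T\epsilon(2\gamma)(1+c\gamma^2)-2K_T\big)\Big)\Big]\le 1$. Here $R_T^{f^*}=R_T^{k^*}$ (Hedge) or $R_T^{u^*}$ (OCO).
   Context: Hedge setting: the experts are indexed by $k\in\mathbb N=\{1,2,\dots\}$. In each round $t=1,2,\dots$ the learner plays a probability mass function $w_t=(w_t^1,w_t^2,\dots)$ on $\mathbb N$; then the losses $\ell_t=(\ell_t^1,\ell_t^2,\dots)$ with $\ell_t^k\in[0,1]$ are revealed and the learner incurs $\langle w_t,\ell_t\rangle=\sum_k w_t^k\ell_t^k$. The regret against expert $k$ is $R_T^k=\sum_{t=1}^T(\langle w_t,\ell_t\rangle-\ell_t^k)$ and $V_T^k=\sum_{t=1}^T(\langle w_t,\ell_t\rangle-\ell_t^k)^2$. The losses are random with an arbitrary (not necessarily i.i.d.) joint distribution $\mathbb P$; $\mathcal G_{t-1}$ is the sigma-algebra generated by $\ell_1,\dots,\ell_{t-1}$, and $w_t$ is $\mathcal G_{t-1}$-measurable.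 It is assumed that there is a fixed expert $k^*$ with $\mathbb E[\ell_t^{k^*}\mid\mathcal G_{t-1}]=\inf_k\mathbb E[\ell_t^k\mid\mathcal G_{t-1}]$ almost surely for all $t$. The excess losses are $x_t^k=\ell_t^k-\ell_t^{k^*}$, indexed by $f=k\in\mathcal F=\mathbb N$. Guarantee (G): for every $T$ and every loss sequence, $R_T^{k^*}\le\sqrt{V_T^{k^*}K_T}+K_T$. OCO setting: the action set $\mathcal U\subseteq\mathbb R^d$ is compact and convex with Euclidean diameter at most $D$. In each round the learner plays $w_t\in\mathcal U$, then a convex loss function $\ell_t:\mathcal U\to\mathbb R$ is revealed, with (a fixed choice of) subgradients satisfying $\|\nabla\ell_t(w)\|_2\le G$ for all $w\in\mathcal U$, where $DG=1$. The regret is $R_T^u=\sum_{t=1}^T(\ell_t(w_t)-\ell_t(u))$, $\tilde R_T^u=\sum_{t=1}^T\langle w_t-u,\nabla\ell_t(w_t)\rangle$, and $V_T^u=\sum_{t=1}^T\langle w_t-u,\nabla\ell_t(w_t)\rangle^2$. The loss functions are random with arbitrary joint distribution $\mathbb P$; $\mathcal G_{t-1}$ is the sigma-algebra generated by $\ell_1,\dots,\ell_{t-1}$, and $w_t$ is $\mathcal G_{t-1}$-measurable. There is a fixed $u^*\in\mathcal U$ attaining $\min_{u\in\mathcal U}\mathbb E[\ell_t(u)\mid\mathcal G_{t-1}]$ for every $t$ almost surely. The excess losses are $x_t^u=\langle u-u^*,\nabla\ell_t(u)\rangle$, indexed by $f=u\in\mathcal F=\mathcal U$. Guarantee (G): for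 every $T$ and every sequence of loss functions, $\tilde R_T^{u^*}\le\sqrt{V_T^{u^*}K_T}+K_T$. Maximal normalized cumulant generating function: for $\eta>0$, $\epsilon(\eta)$ is the smallest number such that $\frac1\eta\ln\mathbb E[e^{-\eta x_t^f}\mid\mathcal G_{t-1}]\le\epsilon(\eta)$ almost surely for all $f\in\mathcal F$ and all $t$. Exponential stochastic inequality: for random variables $X,Y$ and $\eta\ge0$, $X\trianglelefteq_\eta Y$ means $\mathbb E[e^{\eta(X-Y)}]\le 1$. *)

theory Defs
  imports "HOL-Probability.Probability"
begin

definition past_sigma :: "'a measure \<Rightarrow> ('a \<Rightarrow> nat \<Rightarrow> 'l) \<Rightarrow> 'l measure \<Rightarrow> nat \<Rightarrow> 'a measure" where
  "past_sigma M L N s =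
     vimage_algebra (space M) (\<lambda>\<omega>. \<lambda>i\<in>{1..s}. L \<omega> i) (PiM {1..s} (\<lambda>_. N))"

definition max_cgf ::
  "'a measure \<Rightarrow> (nat \<Rightarrow> 'a measure) \<Rightarrow> 'f set \<Rightarrow> ('a \<Rightarrow> nat \<Rightarrow> 'f \<Rightarrow> real) \<Rightarrow> real \<Rightarrow> real" where
  "max_cgf M G Fam x \<eta> =
     Inf {e. \<forall>f\<in>Fam. \<forall>t\<ge>1. AE \<omega> in M.
              ln (real_cond_exp M (G (t - 1)) (\<lambda>\<omega>'. exp (- \<eta> * x \<omega>' t f)) \<omega>) / \<eta> \<le> e}"

definition esi :: "'a measure \<Rightarrow> real \<Rightarrow> ('a \<Rightarrow> real) \<Rightarrow> ('a \<Rightarrow> real) \<Rightarrow> bool" where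
  "esi M \<eta> X Y \<longleftrightarrow> (\<integral>\<^sup>+ \<omega>. ennreal (exp (\<eta> * (X \<omega> - Y \<omega>))) \<partial>M) \<le> 1"

text \<open>Experts are indexed by nat. A loss vector is nat => real; a loss sequence is
  indexed by rounds t = 1, 2, ... (index 0 unused). The learner is a function W with
  w_t = W t l, where l is the loss sequence; it may only depend on l_1..l_{t-1}.\<close>

definition hedge_inner :: "(nat \<Rightarrow> real) \<Rightarrow> (nat \<Rightarrow> real) \<Rightarrow> real" where
  "hedge_inner w l = (\<Sum>k. w k * l k)"

definition is_pmf_nat :: "(nat \<Rightarrow> real) \<Rightarrow> bool" where
  "is_pmf_nat w \<longleftrightarrow> (\<forall>k. 0 \<le> w k) \<and> summable w \<and> (\<Sum>k. w k) = 1"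

definition hedge_valid :: "(nat \<Rightarrow> nat \<Rightarrow> real) \<Rightarrow> bool" where
  "hedge_valid l \<longleftrightarrow> (\<forall>t k. 0 \<le> l t k \<and> l t k \<le> 1)"

definition hedge_regret ::
  "(nat \<Rightarrow> (nat \<Rightarrow> nat \<Rightarrow> real) \<Rightarrow> nat \<Rightarrow> real) \<Rightarrow> (nat \<Rightarrow> nat \<Rightarrow> real) \<Rightarrow> nat \<Rightarrow> nat \<Rightarrow> real" where
  "hedge_regret W l T k = (\<Sum>t=1..T. hedge_inner (W t l) (l t) - l t k)"

definition hedge_V ::
  "(nat \<Rightarrow> (nat \<Rightarrow> nat \<Rightarrow> real) \<Rightarrow> nat \<Rightarrow> real) \<Rightarrow> (nat \<Rightarrow> nat \<Rightarrow> real) \<Rightarrow> nat \<Rightarrow> nat \<Rightarrow> real" where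
  "hedge_V W l T k = (\<Sum>t=1..T. (hedge_inner (W t l) (l t) - l t k)\<^sup>2)"

definition hedge_filt :: "'a measure \<Rightarrow> ('a \<Rightarrow> nat \<Rightarrow> nat \<Rightarrow> real) \<Rightarrow> nat \<Rightarrow> 'a measure" where
  "hedge_filt M L = past_sigma M L (PiM UNIV (\<lambda>_::nat. borel))"

definition hedge_excess :: "('a \<Rightarrow> nat \<Rightarrow> nat \<Rightarrow> real) \<Rightarrow> nat \<Rightarrow> 'a \<Rightarrow> nat \<Rightarrow> nat \<Rightarrow> real" where
  "hedge_excess L kstar \<omega> t k = L \<omega> t k - L \<omega> t kstar"

definition hedge_setting ::
  "'a measure \<Rightarrow> ('a \<Rightarrow> nat \<Rightarrow> nat \<Rightarrow> real) \<Rightarrow> (nat \<Rightarrow> (nat \<Rightarrow> nat \<Rightarrow> real) \<Rightarrow> nat \<Rightarrow> real)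
     \<Rightarrow> (nat \<Rightarrow> real) \<Rightarrow> nat \<Rightarrow> bool" where
  "hedge_setting M L W K kstar \<longleftrightarrow>
     prob_space M \<and>
     \<comment> \<open>random losses in [0,1]\<close>
     (\<forall>t k. (\<lambda>\<omega>. L \<omega> t k) \<in> borel_measurable M) \<and>
     (\<forall>\<omega>\<in>space M. hedge_valid (L \<omega>)) \<and>
     \<comment> \<open>the learner plays pmfs on the experts, based on past losses only\<close>
     (\<forall>t l. hedge_valid l \<longrightarrow> is_pmf_nat (W t l)) \<and>
     (\<forall>t l l'. (\<forall>i\<in>{1..<t}. l i = l' i) \<longrightarrow> W t l = W t l') \<and>
     (\<forall>t\<ge>1. (\<lambda>\<omega>. W t (L \<omega>)) \<in> measurable (hedge_filt M L (t - 1)) (PiM UNIV (\<lambda>_::nat. borel))) \<and>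
     \<comment> \<open>positive deterministic K_T and guarantee (G) for every loss sequence\<close>
     (\<forall>T. 0 < K T) \<and>
     (\<forall>T l. hedge_valid l \<longrightarrow>
        hedge_regret W l T kstar \<le> sqrt (hedge_V W l T kstar * K T) + K T) \<and>
     \<comment> \<open>k* has minimal conditional expected loss in every round\<close>
     (\<forall>t\<ge>1. AE \<omega> in M.
        real_cond_exp M (hedge_filt M L (t - 1)) (\<lambda>\<omega>'. L \<omega>' t kstar) \<omega> =
        (INF k. real_cond_exp M (hedge_filt M L (t - 1)) (\<lambda>\<omega>'. L \<omega>' t k) \<omega>))"

text \<open>Actions in U \<subseteq> real^'d; losses are functions real^'d => real (only their values
  on U matter); sg is the fixed choice of subgradients.\<close>

definition oco_admissible ::
  "(real^'d) set \<Rightarrow> real \<Rightarrow> ((real^'d \<Rightarrow> real) \<Rightarrow> real^'d \<Rightarrow> real^'d) \<Rightarrow> (real^'d \<Rightarrow> real) \<Rightarrow> bool" where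
  "oco_admissible U Gb sg f \<longleftrightarrow>
     convex_on U f \<and>
     (\<forall>w\<in>U. (\<forall>v\<in>U. f w + sg f w \<bullet> (v - w) \<le> f v) \<and> norm (sg f w) \<le> Gb)"

definition oco_regret ::
  "(nat \<Rightarrow> (nat \<Rightarrow> real^'d \<Rightarrow> real) \<Rightarrow> real^'d) \<Rightarrow> (nat \<Rightarrow> real^'d \<Rightarrow> real) \<Rightarrow> nat \<Rightarrow> real^'d \<Rightarrow> real" where
  "oco_regret W l T u = (\<Sum>t=1..T. l t (W t l) - l t u)"

definition oco_lin_regret ::
  "((real^'d \<Rightarrow> real) \<Rightarrow> real^'d \<Rightarrow> real^'d) \<Rightarrow> (nat \<Rightarrow> (nat \<Rightarrow> real^'d \<Rightarrow> real) \<Rightarrow> real^'d)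
     \<Rightarrow> (nat \<Rightarrow> real^'d \<Rightarrow> real) \<Rightarrow> nat \<Rightarrow> real^'d \<Rightarrow> real" where
  "oco_lin_regret sg W l T u = (\<Sum>t=1..T. (W t l - u) \<bullet> sg (l t) (W t l))"

definition oco_V ::
  "((real^'d \<Rightarrow> real) \<Rightarrow> real^'d \<Rightarrow> real^'d) \<Rightarrow> (nat \<Rightarrow> (nat \<Rightarrow> real^'d \<Rightarrow> real) \<Rightarrow> real^'d)
     \<Rightarrow> (nat \<Rightarrow> real^'d \<Rightarrow> real) \<Rightarrow> nat \<Rightarrow> real^'d \<Rightarrow> real" where
  "oco_V sg W l T u = (\<Sum>t=1..T. ((W t l - u) \<bullet> sg (l t) (W t l))\<^sup>2)"

definition oco_filt :: "'a measure \<Rightarrow> (real^'d) set \<Rightarrow> ('a \<Rightarrow> nat \<Rightarrow> real^'d \<Rightarrow> real) \<Rightarrow> nat \<Rightarrow> 'a measure" where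
  "oco_filt M U L = past_sigma M (\<lambda>\<omega> i. restrict (L \<omega> i) U) (PiM U (\<lambda>_. borel))"

definition oco_excess ::
  "((real^'d \<Rightarrow> real) \<Rightarrow> real^'d \<Rightarrow> real^'d) \<Rightarrow> ('a \<Rightarrow> nat \<Rightarrow> real^'d \<Rightarrow> real) \<Rightarrow> real^'d
     \<Rightarrow> 'a \<Rightarrow> nat \<Rightarrow> real^'d \<Rightarrow> real" where
  "oco_excess sg L ustar \<omega> t u = (u - ustar) \<bullet> sg (L \<omega> t) u"

definition oco_setting ::
  "'a measure \<Rightarrow> (real^'d) set \<Rightarrow> real \<Rightarrow> real \<Rightarrow> ((real^'d \<Rightarrow> real) \<Rightarrow> real^'d \<Rightarrow> real^'d)
     \<Rightarrow> ('a \<Rightarrow> nat \<Rightarrow> real^'d \<Rightarrow> real) \<Rightarrow> (nat \<Rightarrow> (nat \<Rightarrow> real^'d \<Rightarrow> real) \<Rightarrow> real^'d)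
     \<Rightarrow> (nat \<Rightarrow> real) \<Rightarrow> real^'d \<Rightarrow> bool" where
  "oco_setting M U D Gb sg L W K ustar \<longleftrightarrow>
     prob_space M \<and>
     \<comment> \<open>compact convex action set of diameter at most D, with D G = 1\<close>
     compact U \<and> convex U \<and> (\<forall>x\<in>U. \<forall>y\<in>U. norm (x - y) \<le> D) \<and> D * Gb = 1 \<and>
     \<comment> \<open>random convex losses with bounded (chosen) subgradients\<close>
     (\<forall>\<omega>\<in>space M. \<forall>t. oco_admissible U Gb sg (L \<omega> t)) \<and>
     (\<forall>t. \<forall>v\<in>U. (\<lambda>\<omega>. L \<omega> t v) \<in> borel_measurable M) \<and>
     (\<forall>t. \<forall>v\<in>U. integrable M (\<lambda>\<omega>. L \<omega> t v)) \<and>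
     (\<forall>t. \<forall>u\<in>U. (\<lambda>\<omega>. oco_excess sg L ustar \<omega> t u) \<in> borel_measurable M) \<and>
     \<comment> \<open>the learner plays in U, based on past losses only\<close>
     (\<forall>t l. (\<forall>i. oco_admissible U Gb sg (l i)) \<longrightarrow> W t l \<in> U) \<and>
     (\<forall>t l l'. (\<forall>i\<in>{1..<t}. l i = l' i) \<longrightarrow> W t l = W t l') \<and>
     (\<forall>t\<ge>1. (\<lambda>\<omega>. W t (L \<omega>)) \<in> measurable (oco_filt M U L (t - 1)) borel) \<and>
     \<comment> \<open>positive deterministic K_T and guarantee (G) for every sequence of loss functions\<close>
     (\<forall>T. 0 < K T) \<and>
     (\<forall>T l. (\<forall>i. oco_admissible U Gb sg (l i)) \<longrightarrow>
        oco_lin_regret sg W l T ustar \<le> sqrt (oco_V sg W l T ustar * K T) + K T) \<and>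
     \<comment> \<open>u* in U minimizes the conditional expected loss in every round\<close>
     ustar \<in> U \<and>
     (\<forall>t\<ge>1. \<forall>u\<in>U. AE \<omega> in M.
        real_cond_exp M (oco_filt M U L (t - 1)) (\<lambda>\<omega>'. L \<omega>' t ustar) \<omega> \<le>
        real_cond_exp M (oco_filt M U L (t - 1)) (\<lambda>\<omega>'. L \<omega>' t u) \<omega>)"

end

theory Submission
  imports Defs
begin

text \<open>
  Write \<open>r\<^sub>t\<close> for the (linearized) regret of round \<open>t\<close>. Since \<open>2 sqrt (V K) \<le> c \<gamma> V + K / (c \<gamma>)\<close>, the
  guarantee gives \<open>R - K / (c \<gamma>) - 2 K \<le> (\<Sum>t. c \<gamma> r\<^sub>t\<^sup>2 - r\<^sub>t)\<close>, so it suffices to bound the conditional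
  expectation of \<open>exp (\<gamma> (c \<gamma> r\<^sub>t\<^sup>2 - r\<^sub>t))\<close>. As a function of \<open>z = exp (-2 \<gamma> r\<^sub>t)\<close> this is concave, by the
  choice of \<open>c\<close>, hence lies below its tangent at \<open>z\<^sub>0 = exp (2 \<gamma> \<epsilon>)\<close>, where \<open>\<epsilon> = \<epsilon>(2 \<gamma>)\<close>. The conditional
  expectation of \<open>z\<close> is at most \<open>z\<^sub>0\<close>, which yields the bound \<open>exp (\<gamma> \<epsilon> + c \<gamma>\<^sup>2 \<epsilon>\<^sup>2)\<close>, and \<open>\<epsilon> \<le> \<gamma>\<close> by
  Hoeffding's lemma.

  For Hedge the bound on \<open>z\<close> is Jensen's inequality. For online convex optimization the cumulant bound
  holds almost surely only for each fixed action, while the action \<open>w\<close> played is random and subgradients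
  are discontinuous. There \<open>r\<^sub>t\<close> is bounded below by the slope of the loss on the segment from
  \<open>w - \<delta> (w - u\<^sup>*)\<close> to \<open>w\<close>, which is measurable and, by monotonicity of subgradients, at least
  \<open>x\<^sup>u - O(\<delta>)\<close> for every \<open>u\<close> within \<open>\<delta>\<^sup>2\<close> of \<open>w - \<delta> (w - u\<^sup>*)\<close>; such \<open>u\<close> can be taken from a countable dense
  set. This suffices because \<open>c \<gamma> r\<^sup>2 - r\<close> is decreasing on \<open>[-1, 1]\<close>.
\<close>

section \<open>Exponential inequalities\<close>

text \<open>The condition on \<open>c\<close> is exactly what makes \<open>z \<mapsto> exp (c (ln z)\<^sup>2 / 4 + ln z / 2)\<close> concave on
  \<open>[exp (-2 \<gamma>), exp (2 \<gamma>)]\<close>; the lemma is the tangent inequality of this function, with \<open>z = exp s\<close>.\<close>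

lemma exp_quadratic_below_tangent:
  fixes c \<gamma> s s0 :: real
  assumes c0: "0 < c" and cdisc: "4 * \<gamma>\<^sup>2 * c\<^sup>2 + 2 * c \<le> 1"
    and s: "\<bar>s\<bar> \<le> 2 * \<gamma>" and s0: "\<bar>s0\<bar> \<le> 2 * \<gamma>"
  shows "exp (c * s\<^sup>2 / 4 + s / 2) \<le>
    exp (c * s0\<^sup>2 / 4 + s0 / 2) * (1 + (c * s0 + 1) / 2 * (exp (s - s0) - 1))"
proof -
  \<comment> \<open>In the variable \<open>z = exp s\<close> the claim is a tangent inequality:
    \<open>h1\<close> and \<open>h2\<close> are the first two derivatives of \<open>h\<close>, and
    \<open>C\<close> is the range of \<open>z\<close> for
    \<open>\<bar>s\<bar> \<le> 2 * \<gamma>\<close>.\<close>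
  define h where "h z = exp (c * (ln z)\<^sup>2 / 4 + ln z / 2)" for z :: real
  define h1 where "h1 z = h z * ((c * ln z + 1) / (2 * z))" for z
  define h2 where "h2 z = h z / z\<^sup>2 * (((c * ln z)\<^sup>2 + 2 * c - 1) / 4)" for z
  define C where "C = {exp (- 2 * \<gamma>)..exp (2 * \<gamma>)}"
  have C_pos: "0 < z" if "z \<in> C" for z
    using that unfolding C_def by (auto intro: less_le_trans[OF exp_gt_zero])
  have d1: "(h has_real_derivative h1 z) (at z)" if "0 < z" for z
    unfolding h_def h1_def using that
    by (auto intro!: derivative_eq_intros simp: field_simps power2_eq_square)
  have d2: "(h1 has_real_derivative h2 z) (at z)" if "0 < z" for z
    unfolding h1_def using that
    by (auto intro!: derivative_eq_intros d1)
      (simp add: h1_def h2_def field_simps power2_eq_square)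
  \<comment> \<open>The sign of \<open>h2 z\<close> is that of
    \<open>(c * ln z)\<^sup>2 + 2 * c - 1\<close>, which on \<open>C\<close> is at most
    \<open>4 * \<gamma>\<^sup>2 * c\<^sup>2 + 2 * c - 1\<close>.\<close>
  have neg: "- h2 z \<ge> 0" if "z \<in> C" for z
  proof -
    have "- 2 * \<gamma> \<le> ln z"
      using that C_pos[OF that] by (subst ln_ge_iff) (auto simp: C_def)
    moreover have "ln z \<le> ln (exp (2 * \<gamma>))"
      using that C_pos[OF that] by (subst ln_le_cancel_iff) (auto simp: C_def)
    ultimately have "\<bar>ln z\<bar> \<le> 2 * \<gamma>"
      by simp
    then have "(ln z)\<^sup>2 \<le> (2 * \<gamma>)\<^sup>2"
      by (metis abs_ge_zero power2_abs power_mono)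
    then have "c\<^sup>2 * (ln z)\<^sup>2 \<le> c\<^sup>2 * (4 * \<gamma>\<^sup>2)"
      by (intro mult_left_mono) (auto simp: power_mult_distrib)
    then have "(c * ln z)\<^sup>2 + 2 * c - 1 \<le> 0"
      using cdisc by (simp add: power_mult_distrib mult_ac)
    then show ?thesis
      by (simp add: h2_def h_def mult_nonneg_nonpos divide_nonpos_nonneg)
  qed
  have mem: "exp s \<in> C" "exp s0 \<in> C"
    using s s0 by (auto simp: C_def abs_le_iff)
  \<comment> \<open>The tangent inequality is available for convex functions, hence the passage to
    \<open>- h\<close>.\<close>
  have "- h1 (exp s0) * (exp s - exp s0) \<le> - h (exp s) - - h (exp s0)"
    by (rule f''_imp_f'[of C "\<lambda>z. - h z" "\<lambda>z. - h1 z" "\<lambda>z. - h2 z"])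
      (use neg mem in \<open>auto simp: C_def[symmetric] intro!: derivative_eq_intros d1 d2 C_pos\<close>, simp add: C_def)
  then have "h (exp s) \<le> h (exp s0) + h1 (exp s0) * (exp s - exp s0)"
    by simp
  also have "\<dots> = h (exp s0) * (1 + (c * s0 + 1) / 2 * (exp (s - s0) - 1))"
    by (simp add: h1_def exp_diff field_simps)
  finally show ?thesis
    by (simp add: h_def)
qed

text \<open>Hoeffding's bound for a fair sign, whose moment generating function is
  \<open>cosh\<close>. Factoring out \<open>exp (- y)\<close> gives the standard form with weight
  \<open>1 / 2\<close> and width \<open>2 * y\<close>; evenness covers negative
  \<open>y\<close>.\<close>

lemma cosh_le_exp_half_square: "cosh (y::real) \<le> exp (y\<^sup>2 / 2)"
proof -
  have *: "cosh y \<le> exp (y\<^sup>2 / 2)" if "0 \<le> y" for y :: real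
  proof -
    have cosh_eq: "cosh y = exp (- y) * (1 + 1 / 2 * (exp (2 * y) - 1))"
      by (simp add: cosh_field_def algebra_simps flip: exp_add)
    have "exp (2 * y) \<ge> 1"
      using that by simp
    then have pos: "0 < 1 + 1 / 2 * (exp (2 * y) - 1)"
      by (intro add_pos_nonneg) auto
    have "ln (cosh y) = - (2 * y) * (1 / 2) + ln (1 + 1 / 2 * (exp (2 * y) - 1))"
      unfolding cosh_eq using pos by (subst ln_mult_pos) auto
    also have "\<dots> \<le> (2 * y)\<^sup>2 / 8"
      by (rule Hoeffdings_lemma_aux) (use that in auto)
    finally have "ln (cosh y) \<le> y\<^sup>2 / 2"
      by (simp add: power_mult_distrib)
    then show ?thesis
      by (metis cosh_real_pos exp_le_cancel_iff exp_ln)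
  qed
  show ?thesis
    using *[of "\<bar>y\<bar>"] by simp
qed

text \<open>By convexity the exponential lies below its chord over \<open>[-1, 1]\<close>. The chord
  is affine in \<open>x\<close>, so its conditional expectation depends on the conditional mean of
  \<open>x\<close> alone.\<close>

lemma exp_le_chord:
  fixes \<eta> x :: real
  assumes "\<bar>x\<bar> \<le> 1"
  shows "exp (- \<eta> * x) \<le> cosh \<eta> - x * sinh \<eta>"
proof -
  have "exp (- \<eta> * x) = exp ((1 - (1 - x) / 2) *\<^sub>R (- \<eta>) + ((1 - x) / 2) *\<^sub>R \<eta>)"
    by (simp add: field_simps)
  also have "\<dots> \<le> (1 - (1 - x) / 2) * exp (- \<eta>) + (1 - x) / 2 * exp \<eta>"
    by (rule convex_onD[OF exp_convex]) (use assms in auto)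
  also have "\<dots> = cosh \<eta> - x * sinh \<eta>"
    by (simp add: cosh_field_def sinh_field_def field_simps)
  finally show ?thesis .
qed

text \<open>The difference of the two sides factors as \<open>(r - d) * (a * (r + d) - 1)\<close>,
  with second factor nonpositive. This lets a lower surrogate \<open>d\<close> replace the regret
  \<open>r\<close>.\<close>

lemma quadratic_decreasing:
  fixes a r d :: real
  assumes "0 \<le> a" "2 * a \<le> 1" "d \<le> r" "r \<le> 1" "d \<le> 1"
  shows "a * r\<^sup>2 - r \<le> a * d\<^sup>2 - d"
proof -
  have "a * (r + d) \<le> a * 2"
    using assms by (intro mult_left_mono) auto
  then have "(r - d) * (a * (r + d) - 1) \<le> 0"
    using assms by (intro mult_nonneg_nonpos) auto
  then show ?thesis
    by (simp add: algebra_simps power2_eq_square)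
qed

text \<open>AM-GM is applied to \<open>c * \<gamma> * V\<close> and
  \<open>K / (c * \<gamma>)\<close>, where \<open>V\<close> is the sum of squares; their product is
  \<open>V * K\<close>. The argument is purely pointwise, so \<open>r\<close> may later be
  non-measurable.\<close>

lemma second_order_regret_le:
  fixes \<gamma> K :: real and r d :: "nat \<Rightarrow> real"
  defines "c \<equiv> 1 / (1 + sqrt (1 + 4 * \<gamma>\<^sup>2))"
  assumes \<gamma>: "0 < \<gamma>" and K: "0 < K"
    and R: "R \<le> (\<Sum>t=1..T. r t)"
    and G: "(\<Sum>t=1..T. r t) \<le> sqrt ((\<Sum>t=1..T. (r t)\<^sup>2) * K) + K"
    and d: "\<And>t. t \<in> {1..T} \<Longrightarrow> d t \<le> r t \<and> r t \<le> 1"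
  shows "R - (K / (c * \<gamma>) + 2 * K) \<le> (\<Sum>t=1..T. c * \<gamma> * (d t)\<^sup>2 - d t)"
proof -
  let ?V = "\<Sum>t=1..T. (r t)\<^sup>2"
  have "2 * \<gamma> \<le> sqrt (1 + 4 * \<gamma>\<^sup>2)"
    by (rule real_le_rsqrt) (simp add: power_mult_distrib)
  then have c: "0 < c" "2 * (c * \<gamma>) \<le> 1"
    using \<gamma> by (auto simp: c_def field_simps intro: add_pos_nonneg)
  have V: "0 \<le> ?V"
    by (simp add: sum_nonneg)
  have "2 * sqrt (?V * K) \<le> c * \<gamma> * ?V + K / (c * \<gamma>)"
  proof -
    have "?V * K = (c * \<gamma> * ?V) * (K / (c * \<gamma>))"
      using c \<gamma> by simp
    then show ?thesis
      using arith_geo_mean_sqrt[of "c * \<gamma> * ?V" "K / (c * \<gamma>)"] c \<gamma> K V by simp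
  qed
  \<comment> \<open>Writing \<open>R \<le> 2 * S - S\<close> for the sum \<open>S\<close> of the
    \<open>r t\<close>, the guarantee is applied to \<open>2 * S\<close>; the remaining
    \<open>- S\<close> supplies the linear term of the exponent.\<close>
  then have "R - (K / (c * \<gamma>) + 2 * K) \<le> c * \<gamma> * ?V - (\<Sum>t=1..T. r t)"
    using R G by linarith
  also have "\<dots> = (\<Sum>t=1..T. c * \<gamma> * (r t)\<^sup>2 - r t)"
    by (simp add: sum_subtractf sum_distrib_left)
  also have "\<dots> \<le> (\<Sum>t=1..T. c * \<gamma> * (d t)\<^sup>2 - d t)"
    using c \<gamma> d by (intro sum_mono quadratic_decreasing) (auto intro: order_trans)
  finally show ?thesis .
qed

section \<open>Excess losses along a filtration\<close>

text \<open>Working with \<open>nn_cond_exp\<close> avoids any integrability condition on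
  \<open>Y\<close>. Since \<open>f\<close> is nonnegative and bounded, its real conditional
  expectation is the finite nonnegative one, and the bound \<open>z\<close> can be integrated
  against the \<open>F\<close>-measurable weight \<open>Y\<close>.\<close>

lemma (in sigma_finite_subalgebra) nn_integral_mult_le_cond_exp_bound:
  fixes f :: "'a \<Rightarrow> real" and Y :: "'a \<Rightarrow> ennreal"
  assumes Y [measurable]: "Y \<in> borel_measurable F"
    and f [measurable]: "f \<in> borel_measurable M"
    and f_nonneg: "AE \<omega> in M. 0 \<le> f \<omega>" and f_le: "AE \<omega> in M. f \<omega> \<le> B"
    and z: "AE \<omega> in M. real_cond_exp M F f \<omega> \<le> z"
  shows "(\<integral>\<^sup>+\<omega>. Y \<omega> * ennreal (f \<omega>) \<partial>M) \<le> ennreal z * (\<integral>\<^sup>+\<omega>. Y \<omega> \<partial>M)"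
proof -
  have [measurable]: "Y \<in> borel_measurable M"
    using measurable_from_subalg[OF subalg Y] .
  have "AE \<omega> in M. nn_cond_exp M F (\<lambda>\<omega>. ennreal (- f \<omega>)) \<omega> = nn_cond_exp M F (\<lambda>\<omega>. 0) \<omega>"
    by (rule nn_cond_exp_cong) (use f_nonneg in \<open>auto simp: ennreal_neg\<close>)
  moreover have "AE \<omega> in M. 0 = nn_cond_exp M F (\<lambda>\<omega>. 0) \<omega>"
    by (rule nn_cond_exp_F_meas) simp
  ultimately have neg: "AE \<omega> in M. nn_cond_exp M F (\<lambda>\<omega>. ennreal (- f \<omega>)) \<omega> = 0"
    by eventually_elim simp
  \<comment> \<open>Finiteness is essential: \<open>enn2real\<close> sends infinity to 0, so a bound
    on the real version alone would say nothing there.\<close>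
  have "AE \<omega> in M. nn_cond_exp M F (\<lambda>\<omega>. ennreal (f \<omega>)) \<omega> \<le> nn_cond_exp M F (\<lambda>\<omega>. ennreal B) \<omega>"
    by (rule nn_cond_exp_mono) (use f_le in \<open>auto simp: ennreal_leI\<close>)
  moreover have "AE \<omega> in M. ennreal B = nn_cond_exp M F (\<lambda>\<omega>. ennreal B) \<omega>"
    by (rule nn_cond_exp_F_meas) simp
  ultimately have fin: "AE \<omega> in M. nn_cond_exp M F (\<lambda>\<omega>. ennreal (f \<omega>)) \<omega> < \<infinity>"
    by eventually_elim (metis ennreal_less_top infinity_ennreal_def order_le_less_trans)
  have bound: "AE \<omega> in M. nn_cond_exp M F (\<lambda>\<omega>. ennreal (f \<omega>)) \<omega> \<le> ennreal z"
    using neg fin z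
  proof eventually_elim
    case (elim \<omega>)
    then have "enn2real (nn_cond_exp M F (\<lambda>\<omega>. ennreal (f \<omega>)) \<omega>) \<le> z"
      by (simp add: real_cond_exp_def)
    then show ?case
      using elim(2) by (metis ennreal_enn2real ennreal_leI infinity_ennreal_def)
  qed
  have "(\<integral>\<^sup>+\<omega>. Y \<omega> * ennreal (f \<omega>) \<partial>M)
      = (\<integral>\<^sup>+\<omega>. Y \<omega> * nn_cond_exp M F (\<lambda>\<omega>. ennreal (f \<omega>)) \<omega> \<partial>M)"
    by (rule nn_cond_exp_intg[symmetric]) auto
  also have "\<dots> \<le> (\<integral>\<^sup>+\<omega>. ennreal z * Y \<omega> \<partial>M)"
    using bound
    by (intro nn_integral_mono_AE, elim eventually_mono)
      (simp add: mult.commute[of "ennreal z"] mult_left_mono)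
  also have "\<dots> = ennreal z * (\<integral>\<^sup>+\<omega>. Y \<omega> \<partial>M)"
    by (rule nn_integral_cmult) simp
  finally show ?thesis .
qed

text \<open>Common ground of the two settings. \<open>F t\<close> is the history including round
  \<open>t\<close>, so round \<open>t\<close> is conditioned on \<open>F (t - 1)\<close>; optimality
  of \<open>fstar\<close> is recorded as nonnegative conditional means of the excess losses.\<close>

locale excess_losses = prob_space M for M :: "'a measure" +
  fixes F :: "nat \<Rightarrow> 'a measure" and Fam :: "'f set"
    and x :: "'a \<Rightarrow> nat \<Rightarrow> 'f \<Rightarrow> real" and fstar :: 'f
  assumes subalg: "subalgebra M (F t)"
    and sets_F_mono: "s \<le> t \<Longrightarrow> sets (F s) \<subseteq> sets (F t)"
    and x_measurable: "f \<in> Fam \<Longrightarrow> 1 \<le> t \<Longrightarrow> (\<lambda>\<omega>. x \<omega> t f) \<in> borel_measurable M"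
    and x_bound: "f \<in> Fam \<Longrightarrow> 1 \<le> t \<Longrightarrow> \<omega> \<in> space M \<Longrightarrow> \<bar>x \<omega> t f\<bar> \<le> 1"
    and fstar: "fstar \<in> Fam"
    and x_fstar: "x \<omega> t fstar = 0"
    and cond_mean_nonneg: "f \<in> Fam \<Longrightarrow> 1 \<le> t \<Longrightarrow>
      AE \<omega> in M. 0 \<le> real_cond_exp M (F (t - 1)) (\<lambda>\<omega>'. x \<omega>' t f) \<omega>"
begin

lemma sigma_finite_subalg: "sigma_finite_subalgebra M (F t)"
  by (intro finite_measure_subalgebra_is_sigma_finite finite_measure_subalgebra.intro
      finite_measure_axioms finite_measure_subalgebra_axioms.intro subalg)

lemma subalgebra_mono: "s \<le> t \<Longrightarrow> subalgebra (F t) (F s)"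
  using sets_F_mono subalg[of s] subalg[of t] by (auto simp: subalgebra_def)

section \<open>Bounds for the maximal cumulant generating function\<close>

abbreviation cgf_bounds :: "real \<Rightarrow> real set" where
  "cgf_bounds \<eta> \<equiv> {e. \<forall>f\<in>Fam. \<forall>t\<ge>1. AE \<omega> in M.
     ln (real_cond_exp M (F (t - 1)) (\<lambda>\<omega>'. exp (- \<eta> * x \<omega>' t f)) \<omega>) / \<eta> \<le> e}"

lemma exp_x_bounds:
  assumes "f \<in> Fam" "1 \<le> t" "\<omega> \<in> space M" "0 < \<eta>"
  shows "exp (- \<eta>) \<le> exp (- \<eta> * x \<omega> t f)" "exp (- \<eta> * x \<omega> t f) \<le> exp \<eta>"
proof -
  have "\<bar>\<eta> * x \<omega> t f\<bar> \<le> \<eta>"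
    using mult_left_mono[OF x_bound[OF assms(1-3)], of \<eta>] assms(4) by (simp add: abs_mult)
  then show "exp (- \<eta>) \<le> exp (- \<eta> * x \<omega> t f)" "exp (- \<eta> * x \<omega> t f) \<le> exp \<eta>"
    by (auto simp: abs_le_iff)
qed

lemma integrable_x:
  assumes "f \<in> Fam" "1 \<le> t"
  shows "integrable M (\<lambda>\<omega>. x \<omega> t f)"
  by (rule integrable_const_bound[of _ 1]) (use assms x_bound x_measurable in auto)

lemma integrable_exp_x:
  assumes "f \<in> Fam" "1 \<le> t" "0 < \<eta>"
  shows "integrable M (\<lambda>\<omega>. exp (- \<eta> * x \<omega> t f))"
proof (rule integrable_const_bound[of _ "exp \<eta>"])
  have [measurable]: "(\<lambda>\<omega>. x \<omega> t f) \<in> borel_measurable M"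
    using x_measurable assms by blast
  show "(\<lambda>\<omega>. exp (- \<eta> * x \<omega> t f)) \<in> borel_measurable M"
    by measurable
qed (use exp_x_bounds[OF assms(1,2) _ assms(3)] in auto)

lemma cond_exp_exp_x_pos:
  assumes "f \<in> Fam" "1 \<le> t" "0 < \<eta>"
  shows "AE \<omega> in M. 0 < real_cond_exp M (F (t - 1)) (\<lambda>\<omega>'. exp (- \<eta> * x \<omega>' t f)) \<omega>"
  by (rule sigma_finite_subalgebra.real_cond_exp_gr_c[OF sigma_finite_subalg integrable_exp_x[OF assms]])
    auto

text \<open>The excess loss of \<open>fstar\<close> vanishes, so its cumulant generating function is
  0 already in round 1. This bounds the set below, as a real \<open>Inf\<close> requires.\<close>

lemma cgf_bounds_nonneg:
  assumes "e \<in> cgf_bounds \<eta>" "0 < \<eta>"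
  shows "0 \<le> e"
proof -
  interpret G: sigma_finite_subalgebra M "F 0"
    by (rule sigma_finite_subalg)
  have "AE \<omega> in M. ln (real_cond_exp M (F (1 - 1)) (\<lambda>\<omega>'. exp (- \<eta> * x \<omega>' 1 fstar)) \<omega>) / \<eta> \<le> e"
    using assms fstar by blast
  moreover have "AE \<omega> in M. real_cond_exp M (F 0) (\<lambda>_. 1) \<omega> = 1"
    by (rule G.real_cond_exp_F_meas) auto
  ultimately have "AE \<omega> in M. 0 \<le> e"
    by eventually_elim (simp add: x_fstar)
  then show ?thesis
    by simp
qed

text \<open>The optimality of \<open>fstar\<close> enters only here, through Hoeffding's lemma.\<close>

lemma min_half_in_cgf_bounds:
  assumes "0 < \<eta>"
  shows "min 1 (\<eta> / 2) \<in> cgf_bounds \<eta>"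
proof (intro CollectI ballI allI impI)
  fix f and t :: nat assume f: "f \<in> Fam" "1 \<le> t"
  interpret G: sigma_finite_subalgebra M "F (t - 1)"
    by (rule sigma_finite_subalg)
  let ?E = "real_cond_exp M (F (t - 1))"
  have [simp]: "integrable M (\<lambda>\<omega>. x \<omega> t f)"
    using integrable_x f by blast
  have "AE \<omega> in M. ?E (\<lambda>\<omega>'. exp (- \<eta> * x \<omega>' t f)) \<omega> \<le> ?E (\<lambda>\<omega>'. cosh \<eta> - sinh \<eta> * x \<omega>' t f) \<omega>"
    by (rule G.real_cond_exp_mono)
      (use exp_le_chord[OF x_bound[OF f]] integrable_exp_x[OF f assms] in \<open>auto simp: mult.commute\<close>)
  moreover have "AE \<omega> in M. ?E (\<lambda>\<omega>'. cosh \<eta> - sinh \<eta> * x \<omega>' t f) \<omega>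
      = ?E (\<lambda>_. cosh \<eta>) \<omega> - ?E (\<lambda>\<omega>'. sinh \<eta> * x \<omega>' t f) \<omega>"
    by (rule G.real_cond_exp_diff) auto
  moreover have "AE \<omega> in M. ?E (\<lambda>_. cosh \<eta>) \<omega> = cosh \<eta>"
    by (rule G.real_cond_exp_F_meas) auto
  moreover have "AE \<omega> in M. ?E (\<lambda>\<omega>'. sinh \<eta> * x \<omega>' t f) \<omega> = sinh \<eta> * ?E (\<lambda>\<omega>'. x \<omega>' t f) \<omega>"
    by (rule G.real_cond_exp_cmult) auto
  ultimately show "AE \<omega> in M. ln (?E (\<lambda>\<omega>'. exp (- \<eta> * x \<omega>' t f)) \<omega>) / \<eta> \<le> min 1 (\<eta> / 2)"
    using cond_mean_nonneg[OF f] cond_exp_exp_x_pos[OF f assms]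
  proof eventually_elim
    case (elim \<omega>)
    have "0 \<le> sinh \<eta> * ?E (\<lambda>\<omega>'. x \<omega>' t f) \<omega>"
      using elim(5) assms by simp
    then have le_cosh: "?E (\<lambda>\<omega>'. exp (- \<eta> * x \<omega>' t f)) \<omega> \<le> cosh \<eta>"
      using elim by linarith
    \<comment> \<open>Two bounds on \<open>cosh \<eta>\<close> are combined: this one yields the
      value 1 in the minimum, the Gaussian one yields \<open>\<eta> / 2\<close>.\<close>
    have "cosh \<eta> \<le> exp \<eta>"
      using assms by (simp add: cosh_field_def)
    then have "cosh \<eta> \<le> exp (min \<eta> (\<eta>\<^sup>2 / 2))"
      using cosh_le_exp_half_square[of \<eta>] by (simp add: min_def)
    with le_cosh have "?E (\<lambda>\<omega>'. exp (- \<eta> * x \<omega>' t f)) \<omega> \<le> exp (min \<eta> (\<eta>\<^sup>2 / 2))"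
      by (rule order_trans)
    then have "ln (?E (\<lambda>\<omega>'. exp (- \<eta> * x \<omega>' t f)) \<omega>) \<le> ln (exp (min \<eta> (\<eta>\<^sup>2 / 2)))"
      using elim(6) by (subst ln_le_cancel_iff) auto
    then show ?case
      using assms by (auto simp: field_simps power2_eq_square)
  qed
qed

text \<open>At \<open>\<eta> = 2 * \<gamma>\<close> the upper bound gives both
  \<open>\<epsilon> \<le> 1\<close>, which keeps the tangent point in the region of concavity, and
  \<open>\<epsilon> \<le> \<gamma>\<close>, which absorbs the quadratic term at the end.\<close>

lemma max_cgf_bounds:
  assumes "0 < \<eta>"
  shows "0 \<le> max_cgf M F Fam x \<eta>" "max_cgf M F Fam x \<eta> \<le> min 1 (\<eta> / 2)"
proof -
  show "0 \<le> max_cgf M F Fam x \<eta>"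
    unfolding max_cgf_def
  proof (rule cInf_greatest)
    show "cgf_bounds \<eta> \<noteq> {}"
      using min_half_in_cgf_bounds[OF assms] by blast
  qed (rule cgf_bounds_nonneg[OF _ assms])
  show "max_cgf M F Fam x \<eta> \<le> min 1 (\<eta> / 2)"
    unfolding max_cgf_def
  proof (rule cInf_lower)
    show "bdd_below (cgf_bounds \<eta>)"
      using cgf_bounds_nonneg[OF _ assms] by (rule bdd_belowI)
  qed (rule min_half_in_cgf_bounds[OF assms])
qed

text \<open>The infimum is approached by bounds within \<open>1 / (n + 1)\<close>. For fixed
  \<open>f\<close> and \<open>t\<close> these cost only countably many null sets, so the limit holds
  almost surely.\<close>

lemma cond_exp_le_exp_max_cgf:
  assumes f: "f \<in> Fam" "1 \<le> t" and \<eta>: "0 < \<eta>"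
  shows "AE \<omega> in M. real_cond_exp M (F (t - 1)) (\<lambda>\<omega>'. exp (- \<eta> * x \<omega>' t f)) \<omega>
    \<le> exp (\<eta> * max_cgf M F Fam x \<eta>)"
proof -
  let ?\<epsilon> = "max_cgf M F Fam x \<eta>"
  have "AE \<omega> in M. ln (real_cond_exp M (F (t - 1)) (\<lambda>\<omega>'. exp (- \<eta> * x \<omega>' t f)) \<omega>) / \<eta>
      \<le> ?\<epsilon> + 1 / real (Suc n)" for n
  proof -
    have "Inf (cgf_bounds \<eta>) < ?\<epsilon> + 1 / real (Suc n)"
      unfolding max_cgf_def by simp
    then obtain e where "e \<in> cgf_bounds \<eta>" "e < ?\<epsilon> + 1 / real (Suc n)"
      by (rule cInf_lessD[rotated, THEN bexE]) (use min_half_in_cgf_bounds[OF \<eta>] in blast)+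
    then have "AE \<omega> in M. ln (real_cond_exp M (F (t - 1)) (\<lambda>\<omega>'. exp (- \<eta> * x \<omega>' t f)) \<omega>) / \<eta> \<le> e"
      using f by blast
    then show ?thesis
      by eventually_elim (use \<open>e < _\<close> in linarith)
  qed
  then have "AE \<omega> in M. \<forall>n. ln (real_cond_exp M (F (t - 1)) (\<lambda>\<omega>'. exp (- \<eta> * x \<omega>' t f)) \<omega>) / \<eta>
      \<le> ?\<epsilon> + 1 / real (Suc n)"
    by (simp add: AE_all_countable)
  then show ?thesis
    using cond_exp_exp_x_pos[OF f \<eta>]
  proof eventually_elim
    case (elim \<omega>)
    let ?m = "real_cond_exp M (F (t - 1)) (\<lambda>\<omega>'. exp (- \<eta> * x \<omega>' t f)) \<omega>"
    have "(\<lambda>n. ?\<epsilon> + 1 / real (Suc n)) \<longlonglongrightarrow> ?\<epsilon> + 0"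
      by (intro tendsto_intros LIMSEQ_Suc[OF lim_1_over_n])
    then have "ln ?m / \<eta> \<le> ?\<epsilon> + 0"
      using elim(1) by (intro LIMSEQ_le_const) auto
    then have "ln ?m \<le> \<eta> * ?\<epsilon>"
      using \<eta> by (simp add: field_simps)
    then show ?case
      using elim(2) by (metis exp_le_cancel_iff exp_ln)
  qed
qed

section \<open>Integration along the filtration\<close>

lemma nn_integral_mult_exp_x_le:
  assumes f: "f \<in> Fam" "1 \<le> t" and \<eta>: "0 < \<eta>" and Y: "Y \<in> borel_measurable (F (t - 1))"
  shows "(\<integral>\<^sup>+\<omega>. Y \<omega> * ennreal (exp (- \<eta> * x \<omega> t f)) \<partial>M)
    \<le> ennreal (exp (\<eta> * max_cgf M F Fam x \<eta>)) * (\<integral>\<^sup>+\<omega>. Y \<omega> \<partial>M)"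
  by (rule sigma_finite_subalgebra.nn_integral_mult_le_cond_exp_bound
      [OF sigma_finite_subalg Y borel_measurable_integrable[OF integrable_exp_x[OF f \<eta>]] _ _
        cond_exp_le_exp_max_cgf[OF f \<eta>], of "exp \<eta>"])
    (use exp_x_bounds(2)[OF f _ \<eta>] in auto)

text \<open>Carries the bound from fixed \<open>f\<close> to choices that depend on the past. Each
  \<open>Y * p j\<close> is again a nonnegative \<open>F (t - 1)\<close>-measurable weight, so the
  bound applies to every fixed \<open>q j\<close>; the countable sum commutes with the integral, and
  the weights sum to 1.\<close>

lemma nn_integral_mult_mixture_le:
  fixes p :: "nat \<Rightarrow> 'a \<Rightarrow> real" and d :: "'a \<Rightarrow> real"
  assumes t: "1 \<le> t" and \<eta>: "0 < \<eta>" and Y: "Y \<in> borel_measurable (F (t - 1))"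
    and p: "\<And>j. p j \<in> borel_measurable (F (t - 1))"
    and p_nonneg: "\<And>j \<omega>. \<omega> \<in> space M \<Longrightarrow> 0 \<le> p j \<omega>"
    and p_sum: "\<And>\<omega>. \<omega> \<in> space M \<Longrightarrow> (\<lambda>j. p j \<omega>) sums 1"
    and q: "\<And>j. q j \<in> Fam" and \<kappa>: "0 \<le> \<kappa>"
    and d: "\<And>\<omega>. \<omega> \<in> space M \<Longrightarrow>
      exp (- \<eta> * d \<omega>) \<le> \<kappa> * (\<Sum>j. p j \<omega> * exp (- \<eta> * x \<omega> t (q j)))"
  shows "(\<integral>\<^sup>+\<omega>. Y \<omega> * ennreal (exp (- \<eta> * d \<omega>)) \<partial>M)
    \<le> ennreal (\<kappa> * exp (\<eta> * max_cgf M F Fam x \<eta>)) * (\<integral>\<^sup>+\<omega>. Y \<omega> \<partial>M)"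
proof -
  let ?z = "exp (\<eta> * max_cgf M F Fam x \<eta>)"
  let ?e = "\<lambda>j \<omega>. exp (- \<eta> * x \<omega> t (q j))"
  note [measurable] = measurable_from_subalg[OF subalg Y] measurable_from_subalg[OF subalg p]
    x_measurable[OF q t]
  have Yp: "(\<lambda>\<omega>. Y \<omega> * ennreal (p j \<omega>)) \<in> borel_measurable (F (t - 1))" for j
    by (intro borel_measurable_times_ennreal Y measurable_compose[OF p] measurable_ennreal)
  have dominated: "Y \<omega> * ennreal (exp (- \<eta> * d \<omega>))
      \<le> ennreal \<kappa> * (\<Sum>j. Y \<omega> * ennreal (p j \<omega>) * ennreal (?e j \<omega>))" if \<omega>: "\<omega> \<in> space M" for \<omega>
  proof -
    \<comment> \<open>The real series has to converge before \<open>ennreal\<close> may be moved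
      inside it.\<close>
    have "summable (\<lambda>j. p j \<omega> * ?e j \<omega>)"
    proof (rule summable_comparison_test')
      show "summable (\<lambda>j. p j \<omega> * exp \<eta>)"
        using sums_summable[OF p_sum[OF \<omega>]] by (rule summable_mult2)
      show "norm (p j \<omega> * ?e j \<omega>) \<le> p j \<omega> * exp \<eta>" if "0 \<le> j" for j
        using p_nonneg[OF \<omega>, of j] exp_x_bounds(2)[OF q t \<omega> \<eta>]
        by (simp add: abs_mult mult_left_mono)
    qed
    then have "ennreal (\<Sum>j. p j \<omega> * ?e j \<omega>) = (\<Sum>j. ennreal (p j \<omega> * ?e j \<omega>))"
      using p_nonneg[OF \<omega>] by (intro suminf_ennreal2[symmetric]) auto
    then have "ennreal (exp (- \<eta> * d \<omega>)) \<le> ennreal \<kappa> * (\<Sum>j. ennreal (p j \<omega>) * ennreal (?e j \<omega>))"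
      using ennreal_leI[OF d[OF \<omega>]] \<kappa> p_nonneg[OF \<omega>] by (simp add: ennreal_mult' ennreal_mult'')
    then have "Y \<omega> * ennreal (exp (- \<eta> * d \<omega>))
        \<le> Y \<omega> * (ennreal \<kappa> * (\<Sum>j. ennreal (p j \<omega>) * ennreal (?e j \<omega>)))"
      by (rule mult_left_mono) simp
    then show ?thesis
      by (simp add: mult.assoc mult.left_commute)
  qed
  have "(\<integral>\<^sup>+\<omega>. Y \<omega> * ennreal (exp (- \<eta> * d \<omega>)) \<partial>M)
      \<le> (\<integral>\<^sup>+\<omega>. ennreal \<kappa> * (\<Sum>j. Y \<omega> * ennreal (p j \<omega>) * ennreal (?e j \<omega>)) \<partial>M)"
    by (intro nn_integral_mono dominated)
  also have "\<dots> = ennreal \<kappa> * (\<Sum>j. \<integral>\<^sup>+\<omega>. Y \<omega> * ennreal (p j \<omega>) * ennreal (?e j \<omega>) \<partial>M)"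
    by (subst nn_integral_cmult nn_integral_suminf, measurable)+
  also have "\<dots> \<le> ennreal \<kappa> * (\<Sum>j. ennreal ?z * (\<integral>\<^sup>+\<omega>. Y \<omega> * ennreal (p j \<omega>) \<partial>M))"
    by (intro mult_left_mono suminf_le nn_integral_mult_exp_x_le q t \<eta> Yp) auto
  also have "\<dots> = ennreal \<kappa> * (ennreal ?z * (\<integral>\<^sup>+\<omega>. (\<Sum>j. Y \<omega> * ennreal (p j \<omega>)) \<partial>M))"
    by (subst nn_integral_suminf) auto
  also have "(\<integral>\<^sup>+\<omega>. (\<Sum>j. Y \<omega> * ennreal (p j \<omega>)) \<partial>M) = (\<integral>\<^sup>+\<omega>. Y \<omega> \<partial>M)"
  proof (rule nn_integral_cong)
    fix \<omega> assume "\<omega> \<in> space M"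
    then have "(\<Sum>j. ennreal (p j \<omega>)) = 1"
      using p_sum p_nonneg by (metis ennreal_1 suminf_ennreal_eq)
    then show "(\<Sum>j. Y \<omega> * ennreal (p j \<omega>)) = Y \<omega>"
      by simp
  qed
  finally show ?thesis
    using \<kappa> by (simp add: ennreal_mult mult.assoc)
qed

text \<open>Supermartingale-type induction: the product over the first \<open>T\<close> rounds is
  \<open>F T\<close>-measurable and serves as the weight \<open>Y\<close> in round
  \<open>T + 1\<close>.\<close>

lemma nn_integral_prod_le_power:
  fixes Z :: "nat \<Rightarrow> 'a \<Rightarrow> ennreal"
  assumes Z: "\<And>t. 1 \<le> t \<Longrightarrow> Z t \<in> borel_measurable (F t)"
    and step: "\<And>t Y. 1 \<le> t \<Longrightarrow> Y \<in> borel_measurable (F (t - 1)) \<Longrightarrow>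
      (\<integral>\<^sup>+\<omega>. Y \<omega> * Z t \<omega> \<partial>M) \<le> B * (\<integral>\<^sup>+\<omega>. Y \<omega> \<partial>M)"
  shows "(\<integral>\<^sup>+\<omega>. (\<Prod>t=1..T. Z t \<omega>) \<partial>M) \<le> B ^ T"
proof (induction T)
  case 0
  then show ?case
    by (simp add: emeasure_space_1)
next
  case (Suc T)
  have "(\<lambda>\<omega>. \<Prod>t=1..T. Z t \<omega>) \<in> borel_measurable (F T)"
    by (intro borel_measurable_prod_ennreal measurable_from_subalg[OF subalgebra_mono Z]) auto
  then have "(\<integral>\<^sup>+\<omega>. (\<Prod>t=1..T. Z t \<omega>) * Z (Suc T) \<omega> \<partial>M) \<le> B * (\<integral>\<^sup>+\<omega>. (\<Prod>t=1..T. Z t \<omega>) \<partial>M)"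
    by (intro step) auto
  also have "\<dots> \<le> B * B ^ T"
    using Suc.IH by (rule mult_left_mono) simp
  finally show ?case
    by simp
qed

text \<open>The surrogates \<open>d t\<close> stand for the instantaneous linearized regrets. The slack \<open>\<kappa> > 1\<close> is needed
  only for online convex optimization; it disappears in the limit.\<close>

lemma second_order_esi:
  fixes \<gamma> c :: real and R :: "'a \<Rightarrow> real" and B :: real
  defines "c \<equiv> 1 / (1 + sqrt (1 + 4 * \<gamma>\<^sup>2))"
  assumes \<gamma>: "0 < \<gamma>"
    and surrogate: "\<And>\<kappa>. 1 < \<kappa> \<Longrightarrow> \<exists>d :: nat \<Rightarrow> 'a \<Rightarrow> real.
      (\<forall>t\<ge>1. d t \<in> borel_measurable (F t) \<and> (\<forall>\<omega>\<in>space M. \<bar>d t \<omega>\<bar> \<le> 1) \<and>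
        (\<exists>p q. (\<forall>j. p j \<in> borel_measurable (F (t - 1)) \<and> q j \<in> Fam) \<and>
          (\<forall>\<omega>\<in>space M. (\<forall>j. 0 \<le> p j \<omega>) \<and> (\<lambda>j. p j \<omega>) sums 1 \<and>
            exp (- (2 * \<gamma>) * d t \<omega>) \<le> \<kappa> * (\<Sum>j::nat. p j \<omega> * exp (- (2 * \<gamma>) * x \<omega> t (q j)))))) \<and>
      (\<forall>\<omega>\<in>space M. R \<omega> - B \<le> (\<Sum>t=1..T. c * \<gamma> * (d t \<omega>)\<^sup>2 - d t \<omega>))"
  shows "esi M \<gamma> R (\<lambda>\<omega>. B + real T * max_cgf M F Fam x (2 * \<gamma>) * (1 + c * \<gamma>\<^sup>2))"
proof -
  let ?\<epsilon> = "max_cgf M F Fam x (2 * \<gamma>)"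
  \<comment> \<open>\<open>s0\<close> is the logarithm of the tangent point, \<open>h0\<close> the
    value there. The weight \<open>\<beta>\<close> lies in \<open>[0, 1]\<close> because
    \<open>0 \<le> c * s0 \<le> 1\<close>, so the tangent has nonnegative coefficients and can be
    split in \<open>ennreal\<close>.\<close>
  define s0 where "s0 = 2 * \<gamma> * ?\<epsilon>"
  define h0 where "h0 = exp (c * s0\<^sup>2 / 4 + s0 / 2)"
  define \<beta> where "\<beta> = (c * s0 + 1) / 2"
  have pos: "0 < 1 + sqrt (1 + 4 * \<gamma>\<^sup>2)"
    by (intro add_pos_nonneg) auto
  then have c: "0 < c"
    by (simp add: c_def)
  \<comment> \<open>This identifies \<open>c\<close> as the positive root of
    \<open>4 * \<gamma>\<^sup>2 * c\<^sup>2 + 2 * c = 1\<close>, so the concavity condition holds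
    with equality.\<close>
  have "(1 / c - 1)\<^sup>2 = 1 + 4 * \<gamma>\<^sup>2"
    by (simp add: c_def)
  then have c_quadratic: "4 * \<gamma>\<^sup>2 * c\<^sup>2 + 2 * c = 1"
    using c by (simp add: field_simps power2_eq_square)
  have \<epsilon>: "0 \<le> ?\<epsilon>" "?\<epsilon> \<le> 1" "?\<epsilon> \<le> \<gamma>"
    using max_cgf_bounds[of "2 * \<gamma>"] \<gamma> by auto
  have s0: "0 \<le> s0" "s0 \<le> 2 * \<gamma>"
    unfolding s0_def using \<epsilon> \<gamma> by auto
  have "(2 * \<gamma> * c)\<^sup>2 \<le> 1\<^sup>2"
    using c_quadratic c by (simp add: power_mult_distrib)
  then have "2 * \<gamma> * c \<le> 1"
    by (rule power2_le_imp_le) simp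
  then have "c * s0 \<le> 1"
    using mult_left_mono[OF s0(2) less_imp_le[OF c]] by (simp only: mult.commute)
  then have \<beta>: "0 \<le> \<beta>" "\<beta> \<le> 1"
    using c s0 by (auto simp: \<beta>_def)
  have h0: "0 < h0"
    by (simp add: h0_def)
  \<comment> \<open>\<open>u \<kappa>\<close> collects the deterministic correction and one factor
    per round; it is continuous in \<open>\<kappa>\<close>.\<close>
  define u where "u \<kappa> = exp (- \<gamma> * (real T * ?\<epsilon> * (1 + c * \<gamma>\<^sup>2))) * (h0 * (1 - \<beta> + \<beta> * \<kappa>)) ^ T" for \<kappa>
  let ?I = "\<integral>\<^sup>+\<omega>. ennreal (exp (\<gamma> * (R \<omega> - (B + real T * ?\<epsilon> * (1 + c * \<gamma>\<^sup>2))))) \<partial>M"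
  have I_le: "?I \<le> ennreal (u \<kappa>)" if \<kappa>: "1 < \<kappa>" for \<kappa>
  proof -
    from surrogate[OF \<kappa>] obtain d :: "nat \<Rightarrow> 'a \<Rightarrow> real" where
      d: "\<And>t. 1 \<le> t \<Longrightarrow> d t \<in> borel_measurable (F t)"
        "\<And>t \<omega>. 1 \<le> t \<Longrightarrow> \<omega> \<in> space M \<Longrightarrow> \<bar>d t \<omega>\<bar> \<le> 1"
      and mixture: "\<And>t. 1 \<le> t \<Longrightarrow> \<exists>p q. (\<forall>j. p j \<in> borel_measurable (F (t - 1)) \<and> q j \<in> Fam) \<and>
          (\<forall>\<omega>\<in>space M. (\<forall>j. 0 \<le> p j \<omega>) \<and> (\<lambda>j. p j \<omega>) sums 1 \<and>
            exp (- (2 * \<gamma>) * d t \<omega>) \<le> \<kappa> * (\<Sum>j::nat. p j \<omega> * exp (- (2 * \<gamma>) * x \<omega> t (q j))))"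
      and R_le: "\<And>\<omega>. \<omega> \<in> space M \<Longrightarrow> R \<omega> - B \<le> (\<Sum>t=1..T. c * \<gamma> * (d t \<omega>)\<^sup>2 - d t \<omega>)"
      by (elim exE conjE) blast
    define Z where "Z t \<omega> = ennreal (exp (\<gamma> * (c * \<gamma> * (d t \<omega>)\<^sup>2 - d t \<omega>)))" for t \<omega>
    have Z: "Z t \<in> borel_measurable (F t)" if "1 \<le> t" for t
      using d(1)[OF that] unfolding Z_def by measurable
    have step: "(\<integral>\<^sup>+\<omega>. Y \<omega> * Z t \<omega> \<partial>M) \<le> ennreal (h0 * (1 - \<beta> + \<beta> * \<kappa>)) * (\<integral>\<^sup>+\<omega>. Y \<omega> \<partial>M)"
      if t: "1 \<le> t" and Y: "Y \<in> borel_measurable (F (t - 1))" for t Y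
    proof -
      have [measurable]: "Y \<in> borel_measurable M" "d t \<in> borel_measurable M"
        using measurable_from_subalg[OF subalg] Y d(1)[OF t] by blast+
      \<comment> \<open>The tangent inequality at \<open>s = - 2 * \<gamma> * d t \<omega>\<close>:
        the quadratic exponential is replaced by an affine function of \<open>exp s\<close>, the
        quantity that the cumulant bound controls.\<close>
      have Z_le: "Z t \<omega> \<le> ennreal (h0 * (1 - \<beta>)) + ennreal (h0 * \<beta> * exp (- s0)) * ennreal (exp (- (2 * \<gamma>) * d t \<omega>))"
        if "\<omega> \<in> space M" for \<omega>
      proof -
        have "\<bar>- (2 * \<gamma>) * d t \<omega>\<bar> \<le> 2 * \<gamma>"
          using mult_left_mono[OF d(2)[OF t that], of "2 * \<gamma>"] \<gamma> by (simp add: abs_mult)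
        then have "exp (c * (- (2 * \<gamma>) * d t \<omega>)\<^sup>2 / 4 + - (2 * \<gamma>) * d t \<omega> / 2)
            \<le> h0 * (1 + \<beta> * (exp (- (2 * \<gamma>) * d t \<omega> - s0) - 1))"
          unfolding h0_def \<beta>_def
          by (intro exp_quadratic_below_tangent[of c \<gamma>]) (use c c_quadratic s0 in auto)
        also have "c * (- (2 * \<gamma>) * d t \<omega>)\<^sup>2 / 4 + - (2 * \<gamma>) * d t \<omega> / 2
            = \<gamma> * (c * \<gamma> * (d t \<omega>)\<^sup>2 - d t \<omega>)"
          by (simp add: power_mult_distrib power2_eq_square algebra_simps)
        also have "h0 * (1 + \<beta> * (exp (- (2 * \<gamma>) * d t \<omega> - s0) - 1))
            = h0 * (1 - \<beta>) + h0 * \<beta> * exp (- s0) * exp (- (2 * \<gamma>) * d t \<omega>)"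
          by (simp add: exp_diff exp_minus field_simps)
        finally have "Z t \<omega> \<le> ennreal (h0 * (1 - \<beta>) + h0 * \<beta> * exp (- s0) * exp (- (2 * \<gamma>) * d t \<omega>))"
          unfolding Z_def by (rule ennreal_leI)
        then show ?thesis
          using h0 \<beta> by (simp add: ennreal_plus ennreal_mult)
      qed
      from mixture[OF t] obtain p q where pq: "\<And>j. p j \<in> borel_measurable (F (t - 1))" "\<And>j. q j \<in> Fam"
        "\<And>j \<omega>. \<omega> \<in> space M \<Longrightarrow> 0 \<le> p j \<omega>" "\<And>\<omega>. \<omega> \<in> space M \<Longrightarrow> (\<lambda>j. p j \<omega>) sums 1"
        "\<And>\<omega>. \<omega> \<in> space M \<Longrightarrow>
          exp (- (2 * \<gamma>) * d t \<omega>) \<le> \<kappa> * (\<Sum>j::nat. p j \<omega> * exp (- (2 * \<gamma>) * x \<omega> t (q j)))"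
        by (elim exE conjE) blast
      have mix: "(\<integral>\<^sup>+\<omega>. Y \<omega> * ennreal (exp (- (2 * \<gamma>) * d t \<omega>)) \<partial>M)
          \<le> ennreal (\<kappa> * exp s0) * (\<integral>\<^sup>+\<omega>. Y \<omega> \<partial>M)"
        unfolding s0_def
        by (rule nn_integral_mult_mixture_le[OF t _ Y pq(1) pq(3) pq(4) pq(2) _ pq(5)])
          (use \<gamma> \<kappa> in auto)
      have "(\<integral>\<^sup>+\<omega>. Y \<omega> * Z t \<omega> \<partial>M) \<le> (\<integral>\<^sup>+\<omega>. ennreal (h0 * (1 - \<beta>)) * Y \<omega>
          + ennreal (h0 * \<beta> * exp (- s0)) * (Y \<omega> * ennreal (exp (- (2 * \<gamma>) * d t \<omega>))) \<partial>M)"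
      proof (rule nn_integral_mono)
        fix \<omega> assume "\<omega> \<in> space M"
        from mult_left_mono[OF Z_le[OF this], of "Y \<omega>"]
        show "Y \<omega> * Z t \<omega> \<le> ennreal (h0 * (1 - \<beta>)) * Y \<omega>
          + ennreal (h0 * \<beta> * exp (- s0)) * (Y \<omega> * ennreal (exp (- (2 * \<gamma>) * d t \<omega>)))"
          by (simp add: distrib_left mult_ac)
      qed
      also have "\<dots> = ennreal (h0 * (1 - \<beta>)) * (\<integral>\<^sup>+\<omega>. Y \<omega> \<partial>M)
          + ennreal (h0 * \<beta> * exp (- s0)) * (\<integral>\<^sup>+\<omega>. Y \<omega> * ennreal (exp (- (2 * \<gamma>) * d t \<omega>)) \<partial>M)"
        by (simp add: nn_integral_add nn_integral_cmult)
      also have "\<dots> \<le> ennreal (h0 * (1 - \<beta>)) * (\<integral>\<^sup>+\<omega>. Y \<omega> \<partial>M)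
          + ennreal (h0 * \<beta> * exp (- s0)) * (ennreal (\<kappa> * exp s0) * (\<integral>\<^sup>+\<omega>. Y \<omega> \<partial>M))"
        by (intro add_left_mono mult_left_mono mix) simp
      also have "\<dots> = (ennreal (h0 * (1 - \<beta>)) + ennreal (h0 * \<beta> * exp (- s0)) * ennreal (\<kappa> * exp s0))
          * (\<integral>\<^sup>+\<omega>. Y \<omega> \<partial>M)"
        by (simp add: distrib_right mult.assoc)
      also have "ennreal (h0 * (1 - \<beta>)) + ennreal (h0 * \<beta> * exp (- s0)) * ennreal (\<kappa> * exp s0)
          = ennreal (h0 * (1 - \<beta>) + h0 * \<beta> * exp (- s0) * (\<kappa> * exp s0))"
        using h0 \<beta> \<kappa> by (simp add: ennreal_plus ennreal_mult)
      also have "h0 * (1 - \<beta>) + h0 * \<beta> * exp (- s0) * (\<kappa> * exp s0) = h0 * (1 - \<beta> + \<beta> * \<kappa>)"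
        by (simp add: exp_minus field_simps)
      finally show ?thesis .
    qed
    have "?I \<le> (\<integral>\<^sup>+\<omega>. ennreal (exp (- \<gamma> * (real T * ?\<epsilon> * (1 + c * \<gamma>\<^sup>2)))) * (\<Prod>t=1..T. Z t \<omega>) \<partial>M)"
    proof (rule nn_integral_mono)
      fix \<omega> assume "\<omega> \<in> space M"
      from mult_left_mono[OF R_le[OF this], of \<gamma>] \<gamma>
      have "\<gamma> * (R \<omega> - (B + real T * ?\<epsilon> * (1 + c * \<gamma>\<^sup>2)))
          \<le> - \<gamma> * (real T * ?\<epsilon> * (1 + c * \<gamma>\<^sup>2)) + (\<Sum>t=1..T. \<gamma> * (c * \<gamma> * (d t \<omega>)\<^sup>2 - d t \<omega>))"
        by (simp only: sum_distrib_left[symmetric]) (simp add: algebra_simps)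
      then have "exp (\<gamma> * (R \<omega> - (B + real T * ?\<epsilon> * (1 + c * \<gamma>\<^sup>2))))
          \<le> exp (- \<gamma> * (real T * ?\<epsilon> * (1 + c * \<gamma>\<^sup>2))) *
            (\<Prod>t=1..T. exp (\<gamma> * (c * \<gamma> * (d t \<omega>)\<^sup>2 - d t \<omega>)))"
        by (simp add: exp_sum[symmetric] exp_add[symmetric])
      from ennreal_leI[OF this]
      show "ennreal (exp (\<gamma> * (R \<omega> - (B + real T * ?\<epsilon> * (1 + c * \<gamma>\<^sup>2)))))
          \<le> ennreal (exp (- \<gamma> * (real T * ?\<epsilon> * (1 + c * \<gamma>\<^sup>2)))) * (\<Prod>t=1..T. Z t \<omega>)"
        by (simp add: Z_def prod_ennreal ennreal_mult prod_nonneg)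
    qed
    also have "\<dots> = ennreal (exp (- \<gamma> * (real T * ?\<epsilon> * (1 + c * \<gamma>\<^sup>2)))) * (\<integral>\<^sup>+\<omega>. (\<Prod>t=1..T. Z t \<omega>) \<partial>M)"
      by (intro nn_integral_cmult borel_measurable_prod_ennreal measurable_from_subalg[OF subalg Z]) auto
    also have "\<dots> \<le> ennreal (exp (- \<gamma> * (real T * ?\<epsilon> * (1 + c * \<gamma>\<^sup>2)))) * ennreal (h0 * (1 - \<beta> + \<beta> * \<kappa>)) ^ T"
      by (intro mult_left_mono nn_integral_prod_le_power Z step) auto
    also have "\<dots> = ennreal (u \<kappa>)"
      unfolding u_def using h0 \<beta> \<kappa> by (subst ennreal_power) (auto simp: ennreal_mult'')
    finally show ?thesis .
  qed
  \<comment> \<open>The integral does not depend on \<open>\<kappa>\<close>, so the slack is removed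
    by letting \<open>\<kappa>\<close> decrease to 1.\<close>
  have "((\<lambda>\<kappa>. ennreal (u \<kappa>)) \<longlongrightarrow> ennreal (u 1)) (at_right 1)"
    unfolding u_def by (intro tendsto_intros tendsto_ennrealI)
  then have "?I \<le> ennreal (u 1)"
    by (rule tendsto_lowerbound) (auto simp: eventually_at_filter I_le)
  also have "ennreal (u 1) \<le> 1"
  proof -
    have "h0 = exp (\<gamma> * ?\<epsilon> + c * \<gamma>\<^sup>2 * (?\<epsilon> * ?\<epsilon>))"
      by (simp add: h0_def s0_def power2_eq_square algebra_simps)
    \<comment> \<open>Replacing one factor \<open>\<epsilon>\<close> by \<open>\<gamma>\<close>
      makes the exponent linear in \<open>\<epsilon>\<close>; it then cancels the correction in
      \<open>u\<close> exactly.\<close>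
    also have "\<dots> \<le> exp (\<gamma> * ?\<epsilon> + c * \<gamma>\<^sup>2 * (\<gamma> * ?\<epsilon>))"
      using \<epsilon> c by (auto intro!: mult_left_mono mult_right_mono)
    also have "\<dots> = exp (\<gamma> * ?\<epsilon> * (1 + c * \<gamma>\<^sup>2))"
      by (simp add: algebra_simps)
    finally have "h0 ^ T \<le> exp (\<gamma> * ?\<epsilon> * (1 + c * \<gamma>\<^sup>2)) ^ T"
      using h0 by (intro power_mono) auto
    also have "\<dots> = exp (\<gamma> * (real T * ?\<epsilon> * (1 + c * \<gamma>\<^sup>2)))"
      by (simp add: exp_of_nat_mult[symmetric] mult_ac)
    finally have "u 1 \<le> exp (- \<gamma> * (real T * ?\<epsilon> * (1 + c * \<gamma>\<^sup>2)))
        * exp (\<gamma> * (real T * ?\<epsilon> * (1 + c * \<gamma>\<^sup>2)))"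
      unfolding u_def by (intro mult_left_mono) auto
    then show ?thesis
      by (simp flip: exp_add)
  qed
  finally show ?thesis
    by (simp add: esi_def)
qed

end

section \<open>Sigma-algebras generated by past losses\<close>

lemma measurable_past_sigma:
  assumes "\<And>\<omega> i. \<omega> \<in> space M \<Longrightarrow> L \<omega> i \<in> space N" and "i \<in> {1..s}"
  shows "(\<lambda>\<omega>. L \<omega> i) \<in> measurable (past_sigma M L N s) N"
proof -
  have "(\<lambda>\<omega>. \<lambda>i\<in>{1..s}. L \<omega> i) \<in> measurable (past_sigma M L N s) (PiM {1..s} (\<lambda>_. N))"
    unfolding past_sigma_def
    by (rule measurable_vimage_algebra1) (use assms(1) in \<open>auto simp: space_PiM\<close>)
  from measurable_compose[OF this measurable_component_singleton[OF assms(2)]] assms(2)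
  show ?thesis
    by simp
qed

lemma sets_past_sigma_subset:
  assumes "space N' = space M" and "\<And>i. i \<in> {1..s} \<Longrightarrow> (\<lambda>\<omega>. L \<omega> i) \<in> measurable N' N"
  shows "sets (past_sigma M L N s) \<subseteq> sets N'"
  unfolding past_sigma_def
  by (rule sets_image_in_sets[OF assms(1)]) (intro measurable_restrict assms(2))

lemma subalgebra_past_sigma:
  assumes "\<And>i. (\<lambda>\<omega>. L \<omega> i) \<in> measurable M N"
  shows "subalgebra M (past_sigma M L N s)"
  using sets_past_sigma_subset[of M M, OF refl assms]
  by (simp add: subalgebra_def past_sigma_def)

lemma sets_past_sigma_mono:
  assumes "\<And>i. (\<lambda>\<omega>. L \<omega> i) \<in> measurable M N" and "s \<le> t"
  shows "sets (past_sigma M L N s) \<subseteq> sets (past_sigma M L N t)"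
  by (intro sets_past_sigma_subset measurable_past_sigma measurable_space[OF assms(1)])
    (use assms(2) in \<open>auto simp: past_sigma_def\<close>)

section \<open>Hedge\<close>

text \<open>Jensen's inequality for countable weights: the tangent of \<open>exp\<close> at the mean
  \<open>?m\<close> is summed against \<open>w\<close>, and its linear part averages out.\<close>

lemma exp_hedge_inner_le:
  fixes w y :: "nat \<Rightarrow> real"
  assumes w: "is_pmf_nat w" and y: "\<And>k. \<bar>y k\<bar> \<le> 1" and \<eta>: "0 < \<eta>"
  shows "exp (- \<eta> * hedge_inner w y) \<le> (\<Sum>k. w k * exp (- \<eta> * y k))"
proof -
  let ?m = "- \<eta> * hedge_inner w y"
  have w0: "0 \<le> w k" for k
    using w by (simp add: is_pmf_nat_def)
  have ws: "w sums 1"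
    using w by (simp add: is_pmf_nat_def sums_iff)
  have "summable (\<lambda>k. w k * y k)"
    by (rule summable_comparison_test'[OF sums_summable[OF ws]])
      (use w0 y in \<open>auto simp: abs_mult intro: mult_left_le\<close>)
  then have "(\<lambda>k. w k * y k) sums hedge_inner w y"
    by (simp add: hedge_inner_def summable_sums)
  then have sums: "(\<lambda>k. exp ?m * ((1 - ?m) * w k - \<eta> * (w k * y k)))
      sums (exp ?m * ((1 - ?m) * 1 - \<eta> * hedge_inner w y))"
    by (intro sums_mult sums_diff ws)
  have "\<bar>\<eta> * y k\<bar> \<le> \<eta>" for k
    using mult_left_mono[OF y[of k], of \<eta>] \<eta> by (simp add: abs_mult)
  then have "exp (- \<eta> * y k) \<le> exp \<eta>" for k
    by (simp add: abs_le_iff)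
  then have "summable (\<lambda>k. w k * exp (- \<eta> * y k))"
    by (intro summable_comparison_test'[OF summable_mult2[OF sums_summable[OF ws], of "exp \<eta>"]])
      (use w0 in \<open>auto simp: abs_mult intro!: mult_left_mono\<close>)
  moreover have "exp ?m * ((1 - ?m) * w k - \<eta> * (w k * y k)) \<le> w k * exp (- \<eta> * y k)" for k
  proof -
    have "exp ?m * (1 + (- \<eta> * y k - ?m)) \<le> exp ?m * exp (- \<eta> * y k - ?m)"
      by (intro mult_left_mono exp_ge_add_one_self) simp
    then have "w k * (exp ?m * (1 + (- \<eta> * y k - ?m))) \<le> w k * exp (- \<eta> * y k)"
      using w0 by (intro mult_left_mono) (simp_all add: exp_add[symmetric])
    then show ?thesis
      by (simp add: algebra_simps)
  qed
  ultimately have "(\<Sum>k. exp ?m * ((1 - ?m) * w k - \<eta> * (w k * y k))) \<le> (\<Sum>k. w k * exp (- \<eta> * y k))"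
    using sums by (intro suminf_le) (auto simp: sums_iff)
  then show ?thesis
    using sums by (simp add: sums_iff)
qed

lemma hedge_second_order_esi:
  assumes H: "hedge_setting M L W K kstar" and \<gamma>: "0 < \<gamma>"
  defines "c \<equiv> 1 / (1 + sqrt (1 + 4 * \<gamma>\<^sup>2))"
  shows "esi M \<gamma> (\<lambda>\<omega>. hedge_regret W (L \<omega>) T kstar)
    (\<lambda>\<omega>. K T / (c * \<gamma>) + 2 * K T
      + real T * max_cgf M (hedge_filt M L) UNIV (hedge_excess L kstar) (2 * \<gamma>) * (1 + c * \<gamma>\<^sup>2))"
proof -
  let ?F = "hedge_filt M L"
  interpret prob_space M
    using H by (simp add: hedge_setting_def)
  have L [measurable]: "(\<lambda>\<omega>. L \<omega> t k) \<in> borel_measurable M" for t k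
    using H by (simp add: hedge_setting_def)
  have L_bounds: "0 \<le> L \<omega> t k" "L \<omega> t k \<le> 1" and valid: "hedge_valid (L \<omega>)" if "\<omega> \<in> space M" for \<omega> t k
    using H that by (auto simp: hedge_setting_def hedge_valid_def)
  have pmf: "is_pmf_nat (W t (L \<omega>))" if "\<omega> \<in> space M" for \<omega> t
    using H valid[OF that] by (auto simp: hedge_setting_def)
  have K: "0 < K T"
    using H by (simp add: hedge_setting_def)
  have guarantee: "hedge_regret W (L \<omega>) T kstar \<le> sqrt (hedge_V W (L \<omega>) T kstar * K T) + K T"
    if "\<omega> \<in> space M" for \<omega>
    using H valid[OF that] by (auto simp: hedge_setting_def)
  have W: "(\<lambda>\<omega>. W t (L \<omega>) k) \<in> borel_measurable (?F (t - 1))" if "1 \<le> t" for t k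
  proof -
    have "(\<lambda>\<omega>. W t (L \<omega>)) \<in> measurable (?F (t - 1)) (PiM UNIV (\<lambda>_::nat. borel))"
      using H that by (simp add: hedge_setting_def)
    from measurable_compose[OF this measurable_component_singleton[of k]] show ?thesis
      by simp
  qed
  have L_PiM: "(\<lambda>\<omega>. L \<omega> t) \<in> measurable M (PiM UNIV (\<lambda>_::nat. borel))" for t
    by (rule measurable_PiM_single') auto
  have subalg: "subalgebra M (?F t)" for t
    unfolding hedge_filt_def by (intro subalgebra_past_sigma L_PiM)
  have F_mono: "sets (?F s) \<subseteq> sets (?F t)" if "s \<le> t" for s t
    unfolding hedge_filt_def by (intro sets_past_sigma_mono L_PiM that)
  have L_F: "(\<lambda>\<omega>. L \<omega> t k) \<in> borel_measurable (?F t)" if "1 \<le> t" for t k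
  proof -
    have "(\<lambda>\<omega>. L \<omega> t) \<in> measurable (?F t) (PiM UNIV (\<lambda>_::nat. borel))"
      unfolding hedge_filt_def
      by (rule measurable_past_sigma[OF measurable_space[OF L_PiM]]) (use that in auto)
    from measurable_compose[OF this measurable_component_singleton[of k]] show ?thesis
      by simp
  qed
  interpret excess_losses M ?F UNIV "hedge_excess L kstar" kstar
  proof
    fix k and t :: nat assume t: "1 \<le> t"
    show "(\<lambda>\<omega>. hedge_excess L kstar \<omega> t k) \<in> borel_measurable M"
      by (simp add: hedge_excess_def)
    show "\<bar>hedge_excess L kstar \<omega> t k\<bar> \<le> 1" if "\<omega> \<in> space M" for \<omega>
      using L_bounds[OF that, of t k] L_bounds[OF that, of t kstar]
      by (auto simp: hedge_excess_def abs_le_iff)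
    interpret G: sigma_finite_subalgebra M "?F (t - 1)"
      by (intro finite_measure_subalgebra_is_sigma_finite finite_measure_subalgebra.intro
          finite_measure_axioms finite_measure_subalgebra_axioms.intro subalg)
    let ?E = "real_cond_exp M (?F (t - 1))"
    have int: "integrable M (\<lambda>\<omega>. L \<omega> t k)" for k
      by (rule integrable_const_bound[of _ 1]) (use L_bounds in \<open>auto intro!: AE_I2\<close>)
    have "AE \<omega> in M. ?E (\<lambda>\<omega>'. hedge_excess L kstar \<omega>' t k) \<omega> = ?E (\<lambda>\<omega>'. L \<omega>' t k) \<omega> - ?E (\<lambda>\<omega>'. L \<omega>' t kstar) \<omega>"
      unfolding hedge_excess_def by (intro G.real_cond_exp_diff int)
    moreover have "AE \<omega> in M. ?E (\<lambda>\<omega>'. L \<omega>' t kstar) \<omega> = (INF k. ?E (\<lambda>\<omega>'. L \<omega>' t k) \<omega>)"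
      using H t by (simp add: hedge_setting_def)
    \<comment> \<open>Nonnegativity for all experts at once makes the family bounded below, so that
      the real infimum is a lower bound for each member.\<close>
    moreover have "AE \<omega> in M. \<forall>k. 0 \<le> ?E (\<lambda>\<omega>'. L \<omega>' t k) \<omega>"
      unfolding AE_all_countable by (intro allI G.real_cond_exp_pos) (auto simp: L_bounds)
    ultimately show "AE \<omega> in M. 0 \<le> ?E (\<lambda>\<omega>'. hedge_excess L kstar \<omega>' t k) \<omega>"
    proof eventually_elim
      case (elim \<omega>)
      have "(INF k. ?E (\<lambda>\<omega>'. L \<omega>' t k) \<omega>) \<le> ?E (\<lambda>\<omega>'. L \<omega>' t k) \<omega>"
        by (rule cINF_lower) (use elim(3) in \<open>auto intro: bdd_belowI2[of _ 0]\<close>)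
      then show ?case
        using elim by simp
    qed
  qed (use subalg F_mono in \<open>auto simp: hedge_excess_def\<close>)
  define d where "d t \<omega> = hedge_inner (W t (L \<omega>)) (L \<omega> t) - L \<omega> t kstar" for t \<omega>
  have d_eq: "d t \<omega> = hedge_inner (W t (L \<omega>)) (hedge_excess L kstar \<omega> t)"
    and d_bound: "\<bar>d t \<omega>\<bar> \<le> 1" if \<omega>: "\<omega> \<in> space M" for t \<omega>
  proof -
    let ?w = "W t (L \<omega>)"
    have w: "0 \<le> ?w k" "?w sums 1" for k
      using pmf[OF \<omega>, of t] by (auto simp: is_pmf_nat_def sums_iff)
    have sl: "summable (\<lambda>k. ?w k * L \<omega> t k)"
      by (rule summable_comparison_test'[OF sums_summable[OF w(2)]])
        (use w(1) L_bounds[OF \<omega>] in \<open>auto simp: abs_mult intro: mult_left_le\<close>)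
    \<comment> \<open>As the weights sum to 1, subtracting the loss of \<open>kstar\<close> commutes
      with averaging: the instantaneous regret is the mean excess loss.\<close>
    have "(\<lambda>k. ?w k * L \<omega> t k - ?w k * L \<omega> t kstar) sums (hedge_inner ?w (L \<omega> t) - 1 * L \<omega> t kstar)"
      unfolding hedge_inner_def by (intro sums_diff summable_sums sl sums_mult2 w(2))
    then show "d t \<omega> = hedge_inner ?w (hedge_excess L kstar \<omega> t)"
      by (simp add: d_def hedge_inner_def hedge_excess_def algebra_simps sums_iff)
    have "0 \<le> hedge_inner ?w (L \<omega> t)"
      unfolding hedge_inner_def using w(1) L_bounds[OF \<omega>] by (intro suminf_nonneg sl) auto
    moreover have "hedge_inner ?w (L \<omega> t) \<le> (\<Sum>k. ?w k)"
      unfolding hedge_inner_def using w L_bounds[OF \<omega>]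
      by (intro suminf_le sl) (auto simp: sums_iff intro: mult_left_le)
    moreover have "(\<Sum>k. ?w k) = 1"
      using w(2) by (simp add: sums_iff)
    ultimately show "\<bar>d t \<omega>\<bar> \<le> 1"
      using L_bounds[OF \<omega>, of t kstar] by (simp add: d_def abs_le_iff)
  qed
  show ?thesis
    unfolding c_def
  \<comment> \<open>The mixture weights are the learner's own probabilities, with \<open>q\<close>
    running through the experts; \<open>d\<close> is the exact instantaneous regret.\<close>
  proof (rule second_order_esi[OF \<gamma>], fold c_def, intro exI conjI allI impI ballI)
    fix \<kappa> :: real and t :: nat assume \<kappa>: "1 < \<kappa>" and t: "1 \<le> t"
    have "(\<lambda>\<omega>. W t (L \<omega>) k) \<in> borel_measurable (?F t)" for k
      by (rule measurable_from_subalg[OF subalgebra_mono W[OF t]]) simp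
    then show "d t \<in> borel_measurable (?F t)"
      unfolding d_def hedge_inner_def
      by (intro borel_measurable_diff borel_measurable_suminf borel_measurable_times L_F[OF t])
    show "(\<lambda>\<omega>. W t (L \<omega>) k) \<in> borel_measurable (?F (t - 1))" for k
      by (rule W[OF t])
    fix \<omega> assume \<omega>: "\<omega> \<in> space M"
    show "\<bar>d t \<omega>\<bar> \<le> 1"
      by (rule d_bound[OF \<omega>])
    show "0 \<le> W t (L \<omega>) k" "(\<lambda>k. W t (L \<omega>) k) sums 1" for k
      using pmf[OF \<omega>, of t] by (auto simp: is_pmf_nat_def sums_iff)
    have *: "exp (- (2 * \<gamma>) * d t \<omega>) \<le> (\<Sum>k. W t (L \<omega>) k * exp (- (2 * \<gamma>) * hedge_excess L kstar \<omega> t k))"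
      unfolding d_eq[OF \<omega>] using \<gamma> x_bound[OF _ t \<omega>] by (intro exp_hedge_inner_le pmf[OF \<omega>]) auto
    then have "1 * (\<Sum>k. W t (L \<omega>) k * exp (- (2 * \<gamma>) * hedge_excess L kstar \<omega> t k))
        \<le> \<kappa> * (\<Sum>k. W t (L \<omega>) k * exp (- (2 * \<gamma>) * hedge_excess L kstar \<omega> t k))"
      using \<kappa> by (intro mult_right_mono) (auto intro: order_trans[OF exp_ge_zero])
    with * show "exp (- (2 * \<gamma>) * d t \<omega>)
        \<le> \<kappa> * (\<Sum>k. W t (L \<omega>) k * exp (- (2 * \<gamma>) * hedge_excess L kstar \<omega> t k))"
      by simp
  next
    fix \<omega> assume \<omega>: "\<omega> \<in> space M"
    show "hedge_regret W (L \<omega>) T kstar - (K T / (c * \<gamma>) + 2 * K T)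
        \<le> (\<Sum>t=1..T. c * \<gamma> * (d t \<omega>)\<^sup>2 - d t \<omega>)"
      unfolding c_def
      by (rule second_order_regret_le[OF \<gamma> K, where r = "\<lambda>t. d t \<omega>"])
        (use guarantee[OF \<omega>] d_bound[OF \<omega>] in \<open>auto simp: hedge_regret_def hedge_V_def d_def abs_le_iff\<close>)
  qed auto
qed

section \<open>Online convex optimization\<close>

text \<open>Evaluation at a random point is written as the infimum over a countable dense
  \<open>Q\<close> of \<open>f \<omega> q + C * norm (q - V \<omega>)\<close>. The Lipschitz bound
  makes \<open>f \<omega> (V \<omega>)\<close> a lower bound of these terms, and points of
  \<open>Q\<close> near \<open>V \<omega>\<close> come arbitrarily close to it.\<close>

lemma borel_measurable_lipschitz_eval:
  fixes f :: "'a \<Rightarrow> 'b::euclidean_space \<Rightarrow> real"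
  assumes f: "\<And>v. v \<in> U \<Longrightarrow> (\<lambda>\<omega>. f \<omega> v) \<in> borel_measurable N"
    and V: "V \<in> borel_measurable N" and V_in: "\<And>\<omega>. \<omega> \<in> space N \<Longrightarrow> V \<omega> \<in> U"
    and lip: "\<And>\<omega> u v. \<omega> \<in> space N \<Longrightarrow> u \<in> U \<Longrightarrow> v \<in> U \<Longrightarrow> \<bar>f \<omega> u - f \<omega> v\<bar> \<le> C * norm (u - v)"
    and C: "0 < C"
  shows "(\<lambda>\<omega>. f \<omega> (V \<omega>)) \<in> borel_measurable N"
proof -
  obtain Q where Q: "countable Q" "Q \<subseteq> U" "U \<subseteq> closure Q"
    using separable[of U] by metis
  have lower: "f \<omega> (V \<omega>) \<le> f \<omega> q + C * norm (q - V \<omega>)" if "\<omega> \<in> space N" "q \<in> Q" for \<omega> q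
    using lip[OF that(1), of q "V \<omega>"] V_in[OF that(1)] that Q by (auto simp: abs_le_iff)
  have eq: "(INF q\<in>Q. f \<omega> q + C * norm (q - V \<omega>)) = f \<omega> (V \<omega>)" if \<omega>: "\<omega> \<in> space N" for \<omega>
  proof (rule antisym)
    show "(INF q\<in>Q. f \<omega> q + C * norm (q - V \<omega>)) \<le> f \<omega> (V \<omega>)"
    proof (rule field_le_epsilon)
      fix e :: real assume "0 < e"
      then have "0 < e / (2 * C)"
        using C by simp
      moreover have "V \<omega> \<in> closure Q"
        using V_in[OF \<omega>] Q by blast
      ultimately obtain q where q: "q \<in> Q" "norm (q - V \<omega>) < e / (2 * C)"
        by (auto simp: closure_approachable dist_norm)
      have "(INF q\<in>Q. f \<omega> q + C * norm (q - V \<omega>)) \<le> f \<omega> q + C * norm (q - V \<omega>)"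
        by (rule cINF_lower) (use q lower[OF \<omega>] in \<open>auto intro: bdd_belowI2[of _ "f \<omega> (V \<omega>)"]\<close>)
      also have "f \<omega> q \<le> f \<omega> (V \<omega>) + C * norm (q - V \<omega>)"
        using lip[OF \<omega>, of q "V \<omega>"] V_in[OF \<omega>] q Q by (auto simp: abs_le_iff)
      also have "f \<omega> (V \<omega>) + C * norm (q - V \<omega>) + C * norm (q - V \<omega>) \<le> f \<omega> (V \<omega>) + e"
        using q(2) C by (simp add: field_simps)
      finally show "(INF q\<in>Q. f \<omega> q + C * norm (q - V \<omega>)) \<le> f \<omega> (V \<omega>) + e"
        by simp
    qed
    have "Q \<noteq> {}"
      using V_in[OF \<omega>] Q by auto
    then show "f \<omega> (V \<omega>) \<le> (INF q\<in>Q. f \<omega> q + C * norm (q - V \<omega>))"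
      by (rule cINF_greatest) (rule lower[OF \<omega>])
  qed
  have "(\<lambda>\<omega>. INF q\<in>Q. f \<omega> q + C * norm (q - V \<omega>)) \<in> borel_measurable N"
  proof (rule borel_measurable_cINF[OF Q(1)])
    fix q assume "q \<in> Q"
    then have [measurable]: "(\<lambda>\<omega>. f \<omega> q) \<in> borel_measurable N"
      using f Q by blast
    note V [measurable]
    show "(\<lambda>\<omega>. f \<omega> q + C * norm (q - V \<omega>)) \<in> borel_measurable N"
      by measurable
  qed (rule bdd_belowI2, rule lower)
  then show ?thesis
    by (simp add: measurable_cong[OF eq])
qed

section \<open>Admissible convex losses and slopes along segments\<close>

lemma oco_admissible_subgradient:
  assumes "oco_admissible U Gb sg f" "v \<in> U" "w \<in> U"
  shows "f w + sg f w \<bullet> (v - w) \<le> f v"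
  using assms by (simp add: oco_admissible_def)

lemma oco_admissible_inner_le:
  assumes "oco_admissible U Gb sg f" "w \<in> U"
  shows "\<bar>sg f w \<bullet> z\<bar> \<le> Gb * norm z"
proof -
  have "\<bar>sg f w \<bullet> z\<bar> \<le> norm (sg f w) * norm z"
    by (rule Cauchy_Schwarz_ineq2)
  also have "\<dots> \<le> Gb * norm z"
    using assms by (intro mult_right_mono) (auto simp: oco_admissible_def)
  finally show ?thesis .
qed

lemma oco_admissible_lipschitz:
  assumes f: "oco_admissible U Gb sg f" and "v \<in> U" "w \<in> U"
  shows "\<bar>f v - f w\<bar> \<le> Gb * norm (v - w)"
  using oco_admissible_subgradient[OF f assms(2,3)] oco_admissible_subgradient[OF f assms(3,2)]
    oco_admissible_inner_le[OF f assms(3), of "v - w"] oco_admissible_inner_le[OF f assms(2), of "w - v"]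
  by (simp add: norm_minus_commute abs_le_iff)

text \<open>Replaces the linearized regret \<open>(w - z) \<bullet> sg f w\<close>, which need not be measurable, since \<open>sg f\<close> is an
  arbitrary selection and may depend on \<open>f\<close> outside \<open>U\<close>.\<close>

definition segment_slope :: "real \<Rightarrow> 'b::real_vector \<Rightarrow> ('b \<Rightarrow> real) \<Rightarrow> 'b \<Rightarrow> real" where
  "segment_slope \<delta> z f w = (f w - f (w - \<delta> *\<^sub>R (w - z))) / \<delta>"

lemma convex_segment_point:
  assumes "convex U" "w \<in> U" "z \<in> U" "0 < \<delta>" "\<delta> \<le> 1"
  shows "w - \<delta> *\<^sub>R (w - z) \<in> U"
proof -
  have "w - \<delta> *\<^sub>R (w - z) = (1 - \<delta>) *\<^sub>R w + \<delta> *\<^sub>R z"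
    by (simp add: algebra_simps)
  then show ?thesis
    using assms by (simp add: convexD_alt)
qed

text \<open>The first bound is the subgradient inequality at \<open>w\<close>; the second is the
  Lipschitz bound, normalized by \<open>D * Gb = 1\<close>.\<close>

lemma segment_slope_bounds:
  assumes f: "oco_admissible U Gb sg f" and U: "convex U" "w \<in> U" "z \<in> U"
    and D: "norm (w - z) \<le> D" "D * Gb = 1" and Gb: "0 < Gb" and \<delta>: "0 < \<delta>" "\<delta> \<le> 1"
  shows "segment_slope \<delta> z f w \<le> (w - z) \<bullet> sg f w" "\<bar>segment_slope \<delta> z f w\<bar> \<le> 1"
proof -
  note p = convex_segment_point[OF U \<delta>]
  show "segment_slope \<delta> z f w \<le> (w - z) \<bullet> sg f w"
    using oco_admissible_subgradient[OF f p U(2)] \<delta>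
    by (simp add: segment_slope_def pos_divide_le_eq inner_commute mult.commute)
  have "\<bar>f w - f (w - \<delta> *\<^sub>R (w - z))\<bar> \<le> Gb * (\<delta> * norm (w - z))"
    using oco_admissible_lipschitz[OF f U(2) p] \<delta> by simp
  also have "\<dots> \<le> Gb * (\<delta> * D)"
    using D Gb \<delta> by (intro mult_left_mono) auto
  also have "\<dots> = \<delta>"
    using D(2) by (simp add: mult.left_commute mult.commute)
  finally have "\<bar>f w - f (w - \<delta> *\<^sub>R (w - z))\<bar> \<le> \<delta>" .
  then show "\<bar>segment_slope \<delta> z f w\<bar> \<le> 1"
    using \<delta> by (simp add: segment_slope_def)
qed

text \<open>The subgradient inequality at \<open>u\<close>, tested at \<open>w\<close>, compares
  \<open>sg f u\<close> with the increment of \<open>f\<close> along the segment. The errors are of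
  order \<open>\<delta>\<^sup>2\<close> because of the radius, hence of order
  \<open>\<delta>\<close> after division: \<open>2 * Gb\<close> arises here, and
  \<open>1 + Gb\<close> from replacing \<open>w - z\<close> by \<open>u - z\<close>.\<close>

lemma nearby_excess_le_segment_slope:
  assumes f: "oco_admissible U Gb sg f" and U: "convex U" "w \<in> U" "z \<in> U" "u \<in> U"
    and D: "norm (w - z) \<le> D" "D * Gb = 1" and Gb: "0 < Gb" and \<delta>: "0 < \<delta>" "\<delta> \<le> 1"
    and u: "norm (u - (w - \<delta> *\<^sub>R (w - z))) \<le> \<delta>\<^sup>2"
  shows "(u - z) \<bullet> sg f u \<le> segment_slope \<delta> z f w + \<delta> * (1 + 3 * Gb)"
proof -
  note p = convex_segment_point[OF U(1-3) \<delta>]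
  let ?p = "w - \<delta> *\<^sub>R (w - z)"
  let ?e = "u - ?p"
  let ?g = "sg f u"
  have e: "Gb * norm ?e \<le> Gb * \<delta>\<^sup>2"
    using u Gb by (intro mult_left_mono) auto
  have ge: "\<bar>?g \<bullet> ?e\<bar> \<le> Gb * \<delta>\<^sup>2"
    using oco_admissible_inner_le[OF f U(4), of ?e] e by linarith
  have gw: "\<bar>?g \<bullet> (w - z)\<bar> \<le> 1"
    using oco_admissible_inner_le[OF f U(4), of "w - z"] mult_left_mono[OF D(1), of Gb] D Gb
    by (simp add: mult.commute)
  have wu: "w - u = \<delta> *\<^sub>R (w - z) - ?e"
    by simp
  have "f u + ?g \<bullet> (w - u) \<le> f w"
    by (rule oco_admissible_subgradient[OF f U(2,4)])
  then have "f u + \<delta> * (?g \<bullet> (w - z)) - ?g \<bullet> ?e \<le> f w"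
    unfolding wu by (simp add: inner_diff_right)
  moreover have "f ?p - Gb * \<delta>\<^sup>2 \<le> f u"
    using oco_admissible_lipschitz[OF f U(4) p] e by linarith
  ultimately have "\<delta> * (?g \<bullet> (w - z)) - 2 * Gb * \<delta>\<^sup>2 \<le> f w - f ?p"
    using ge by linarith
  then have slope: "?g \<bullet> (w - z) - 2 * Gb * \<delta> \<le> segment_slope \<delta> z f w"
    using \<delta> by (simp add: segment_slope_def field_simps power2_eq_square)
  have "u - z = (w - z) - \<delta> *\<^sub>R (w - z) + ?e"
    by simp
  then have "?g \<bullet> (u - z) = ?g \<bullet> (w - z) - \<delta> * (?g \<bullet> (w - z)) + ?g \<bullet> ?e"
    by (metis inner_add_right inner_diff_right inner_scaleR_right)
  moreover have "- \<delta> * (?g \<bullet> (w - z)) \<le> \<delta>"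
    using mult_left_mono[of "- (?g \<bullet> (w - z))" 1 \<delta>] gw \<delta> by (simp add: abs_le_iff)
  moreover have "Gb * \<delta>\<^sup>2 \<le> Gb * \<delta>"
    using \<delta> Gb by (simp add: power2_eq_square mult_left_le)
  ultimately show ?thesis
    using slope ge by (simp add: inner_commute algebra_simps)
qed

text \<open>The mixture is a random point mass on a countable dense set of actions, so the cumulant
  bound is only invoked at countably many fixed actions.\<close>

lemma oco_second_order_esi:
  fixes U :: "(real^'d) set"
  assumes H: "oco_setting M U D Gb sg L W K ustar" and \<gamma>: "0 < \<gamma>"
  defines "c \<equiv> 1 / (1 + sqrt (1 + 4 * \<gamma>\<^sup>2))"
  shows "esi M \<gamma> (\<lambda>\<omega>. oco_regret W (L \<omega>) T ustar)
    (\<lambda>\<omega>. K T / (c * \<gamma>) + 2 * K T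
      + real T * max_cgf M (oco_filt M U L) U (oco_excess sg L ustar) (2 * \<gamma>) * (1 + c * \<gamma>\<^sup>2))"
proof -
  let ?F = "oco_filt M U L"
  interpret prob_space M
    using H by (simp add: oco_setting_def)
  have U: "convex U" "ustar \<in> U" and diam: "\<And>u v. u \<in> U \<Longrightarrow> v \<in> U \<Longrightarrow> norm (u - v) \<le> D"
    and DG: "D * Gb = 1" and K: "0 < K T"
    using H by (auto simp: oco_setting_def)
  have adm: "oco_admissible U Gb sg (L \<omega> t)" if "\<omega> \<in> space M" for \<omega> t
    using H that by (simp add: oco_setting_def)
  have "0 \<le> D"
    using diam[OF U(2) U(2)] by simp
  then have Gb: "0 < Gb"
    using DG zero_less_mult_iff[of D Gb] by auto
  have L: "(\<lambda>\<omega>. L \<omega> t v) \<in> borel_measurable M" and L_int: "integrable M (\<lambda>\<omega>. L \<omega> t v)"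
    and excess: "(\<lambda>\<omega>. oco_excess sg L ustar \<omega> t v) \<in> borel_measurable M" if "v \<in> U" for t v
    using H that by (auto simp: oco_setting_def)
  have W_in: "W t (L \<omega>) \<in> U" if "\<omega> \<in> space M" for t \<omega>
    using H adm[OF that] by (auto simp: oco_setting_def)
  have W: "(\<lambda>\<omega>. W t (L \<omega>)) \<in> borel_measurable (?F (t - 1))" if "1 \<le> t" for t
    using H that by (simp add: oco_setting_def)
  have guarantee: "oco_lin_regret sg W (L \<omega>) T ustar \<le> sqrt (oco_V sg W (L \<omega>) T ustar * K T) + K T"
    if "\<omega> \<in> space M" for \<omega>
    using H adm[OF that] by (auto simp: oco_setting_def)
  have L_PiM: "(\<lambda>\<omega>. restrict (L \<omega> t) U) \<in> measurable M (PiM U (\<lambda>_. borel))" for t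
    by (intro measurable_restrict L)
  have subalg: "subalgebra M (?F t)" for t
    unfolding oco_filt_def by (intro subalgebra_past_sigma L_PiM)
  have F_mono: "sets (?F s) \<subseteq> sets (?F t)" if "s \<le> t" for s t
    unfolding oco_filt_def by (intro sets_past_sigma_mono L_PiM that)
  have L_F: "(\<lambda>\<omega>. L \<omega> t v) \<in> borel_measurable (?F t)" if "1 \<le> t" "v \<in> U" for t v
  proof -
    have "(\<lambda>\<omega>. restrict (L \<omega> t) U) \<in> measurable (?F t) (PiM U (\<lambda>_. borel))"
      unfolding oco_filt_def
      by (rule measurable_past_sigma[OF measurable_space[OF L_PiM]]) (use that in auto)
    from measurable_compose[OF this measurable_component_singleton[OF that(2)]] that(2) show ?thesis
      by simp
  qed
  have space_F: "space (?F t) = space M" for t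
    using subalg[of t] by (simp add: subalgebra_def)
  have excess_bound: "\<bar>(u - ustar) \<bullet> sg (L \<omega> t) u\<bar> \<le> 1" if "u \<in> U" "\<omega> \<in> space M" for u \<omega> t
  proof -
    have "\<bar>sg (L \<omega> t) u \<bullet> (u - ustar)\<bar> \<le> Gb * norm (u - ustar)"
      by (rule oco_admissible_inner_le[OF adm[OF that(2)] that(1)])
    also have "\<dots> \<le> Gb * D"
      using Gb diam[OF that(1) U(2)] by simp
    finally show ?thesis
      using DG by (simp add: mult.commute inner_commute)
  qed
  interpret excess_losses M ?F U "oco_excess sg L ustar" ustar
  proof
    fix u and t :: nat assume u: "u \<in> U" and t: "1 \<le> t"
    show "(\<lambda>\<omega>. oco_excess sg L ustar \<omega> t u) \<in> borel_measurable M"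
      by (rule excess[OF u])
    show bound: "\<bar>oco_excess sg L ustar \<omega> t u\<bar> \<le> 1" if "\<omega> \<in> space M" for \<omega>
      using excess_bound[OF u that] by (simp add: oco_excess_def)
    interpret G: sigma_finite_subalgebra M "?F (t - 1)"
      by (intro finite_measure_subalgebra_is_sigma_finite finite_measure_subalgebra.intro
          finite_measure_axioms finite_measure_subalgebra_axioms.intro subalg)
    let ?E = "real_cond_exp M (?F (t - 1))"
    \<comment> \<open>The subgradient inequality at \<open>u\<close> puts the linearized excess
      above the loss difference, whose conditional mean is nonnegative by optimality of
      \<open>ustar\<close>.\<close>
    have "AE \<omega> in M. ?E (\<lambda>\<omega>'. L \<omega>' t u - L \<omega>' t ustar) \<omega> \<le> ?E (\<lambda>\<omega>'. oco_excess sg L ustar \<omega>' t u) \<omega>"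
    proof (rule G.real_cond_exp_mono)
      show "AE \<omega> in M. L \<omega> t u - L \<omega> t ustar \<le> oco_excess sg L ustar \<omega> t u"
      proof (rule AE_I2)
        fix \<omega> assume "\<omega> \<in> space M"
        from oco_admissible_subgradient[OF adm[OF this, of t] U(2) u]
        show "L \<omega> t u - L \<omega> t ustar \<le> oco_excess sg L ustar \<omega> t u"
          by (simp add: oco_excess_def inner_commute inner_diff_right inner_diff_left)
      qed
      show "integrable M (\<lambda>\<omega>. oco_excess sg L ustar \<omega> t u)"
        by (rule integrable_const_bound[of _ 1]) (use bound excess[OF u] in auto)
    qed (use L_int u U in auto)
    moreover have "AE \<omega> in M. ?E (\<lambda>\<omega>'. L \<omega>' t u - L \<omega>' t ustar) \<omega>
        = ?E (\<lambda>\<omega>'. L \<omega>' t u) \<omega> - ?E (\<lambda>\<omega>'. L \<omega>' t ustar) \<omega>"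
      by (intro G.real_cond_exp_diff L_int u U)
    moreover have "AE \<omega> in M. ?E (\<lambda>\<omega>'. L \<omega>' t ustar) \<omega> \<le> ?E (\<lambda>\<omega>'. L \<omega>' t u) \<omega>"
      using H t u by (simp add: oco_setting_def)
    ultimately show "AE \<omega> in M. 0 \<le> ?E (\<lambda>\<omega>'. oco_excess sg L ustar \<omega>' t u) \<omega>"
      by eventually_elim simp
  qed (use subalg F_mono U in \<open>auto simp: oco_excess_def\<close>)
  obtain Q where Q: "countable Q" "Q \<subseteq> U" "U \<subseteq> closure Q"
    using separable[of U] by metis
  define q where "q = from_nat_into Q"
  have "Q \<noteq> {}"
    using Q U by auto
  then have q_range: "range q = Q"
    using Q by (simp add: q_def)
  then have q_in: "q j \<in> U" for j
    using Q by auto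
  show ?thesis
    unfolding c_def
  proof (rule second_order_esi[OF \<gamma>], fold c_def)
    fix \<kappa> :: real assume \<kappa>: "1 < \<kappa>"
    define C where "C = 2 * \<gamma> * (1 + 3 * Gb)"
    have C: "0 < C"
      using \<gamma> Gb by (simp add: C_def)
    \<comment> \<open>Chosen so that the error factor \<open>exp (C * \<delta>)\<close> stays below
      \<open>\<kappa>\<close>; the cap 1 keeps \<open>v\<close> on the segment and hence in
      \<open>U\<close>.\<close>
    define \<delta> where "\<delta> = min 1 (ln \<kappa> / C)"
    have \<delta>: "0 < \<delta>" "\<delta> \<le> 1"
      using \<kappa> C by (auto simp: \<delta>_def)
    have "C * \<delta> \<le> C * (ln \<kappa> / C)"
      using C by (intro mult_left_mono) (auto simp: \<delta>_def)
    then have "exp (C * \<delta>) \<le> exp (ln \<kappa>)"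
      using C by simp
    then have C\<delta>: "exp (C * \<delta>) \<le> \<kappa>"
      using \<kappa> by simp
    define v where "v t \<omega> = W t (L \<omega>) - \<delta> *\<^sub>R (W t (L \<omega>) - ustar)" for t \<omega>
    \<comment> \<open>\<open>J\<close> selects the first dense point near \<open>v\<close>, and
      \<open>p\<close> is the point mass there. Both depend on \<open>\<omega>\<close> only through
      \<open>v\<close>, so they are known before round \<open>t\<close>.\<close>
    define J where "J t \<omega> = (LEAST j. norm (q j - v t \<omega>) \<le> \<delta>\<^sup>2)" for t \<omega>
    define p where "p t j \<omega> = (if j = J t \<omega> then 1 else 0 :: real)" for t j \<omega>
    define d where "d t \<omega> = segment_slope \<delta> ustar (L \<omega> t) (W t (L \<omega>))" for t \<omega>
    have v_in: "v t \<omega> \<in> U" if "\<omega> \<in> space M" for t \<omega>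
      unfolding v_def by (intro convex_segment_point U W_in that \<delta>)
    have v: "v t \<in> borel_measurable (?F (t - 1))" if "1 \<le> t" for t
      using W[OF that] unfolding v_def by measurable
    have J: "norm (q (J t \<omega>) - v t \<omega>) \<le> \<delta>\<^sup>2" if \<omega>: "\<omega> \<in> space M" for t \<omega>
      unfolding J_def
    proof (rule LeastI_ex)
      have "v t \<omega> \<in> closure (range q)"
        using v_in[OF \<omega>] Q q_range by auto
      moreover have "0 < \<delta>\<^sup>2"
        using \<delta> by simp
      ultimately obtain j where "norm (q j - v t \<omega>) < \<delta>\<^sup>2"
        unfolding closure_approachable dist_norm by blast
      then show "\<exists>j. norm (q j - v t \<omega>) \<le> \<delta>\<^sup>2"
        by (auto intro: less_imp_le)
    qed
    have d_bounds: "d t \<omega> \<le> (W t (L \<omega>) - ustar) \<bullet> sg (L \<omega> t) (W t (L \<omega>))" "\<bar>d t \<omega>\<bar> \<le> 1"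
      if "\<omega> \<in> space M" for t \<omega>
      unfolding d_def
      using segment_slope_bounds[OF adm[OF that] U(1) W_in[OF that] U(2) diam[OF W_in[OF that] U(2)] DG Gb \<delta>]
      by auto
    \<comment> \<open>The slope involves only values of the loss at two points of \<open>U\<close>;
      both points are random, so the Lipschitz evaluation lemma is applied twice.\<close>
    have d_F: "d t \<in> borel_measurable (?F t)" if t: "1 \<le> t" for t
    proof -
      have Wt: "(\<lambda>\<omega>. W t (L \<omega>)) \<in> borel_measurable (?F t)" and vt: "v t \<in> borel_measurable (?F t)"
        by (rule measurable_from_subalg[OF subalgebra_mono W[OF t]], simp)
          (rule measurable_from_subalg[OF subalgebra_mono v[OF t]], simp)
      have "(\<lambda>\<omega>. L \<omega> t (W t (L \<omega>))) \<in> borel_measurable (?F t)"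
        by (rule borel_measurable_lipschitz_eval[OF L_F[OF t] Wt _ _ Gb])
          (auto simp: space_F intro: W_in oco_admissible_lipschitz adm)
      moreover have "(\<lambda>\<omega>. L \<omega> t (v t \<omega>)) \<in> borel_measurable (?F t)"
        by (rule borel_measurable_lipschitz_eval[OF L_F[OF t] vt _ _ Gb])
          (auto simp: space_F intro: v_in oco_admissible_lipschitz adm)
      ultimately show ?thesis
        unfolding d_def segment_slope_def v_def by measurable
    qed
    have p_F: "p t j \<in> borel_measurable (?F (t - 1))" if t: "1 \<le> t" for t j
    proof -
      note v[OF t, measurable]
      have [measurable]: "J t \<in> measurable (?F (t - 1)) (count_space UNIV)"
        unfolding J_def by measurable
      show ?thesis
        unfolding p_def by measurable
    qed
    have p_sums: "(\<lambda>j. p t j \<omega>) sums 1" for t \<omega>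
      unfolding p_def by (rule sums_single)
    have mixture: "exp (- (2 * \<gamma>) * d t \<omega>)
        \<le> \<kappa> * (\<Sum>j. p t j \<omega> * exp (- (2 * \<gamma>) * oco_excess sg L ustar \<omega> t (q j)))"
      if \<omega>: "\<omega> \<in> space M" for t \<omega>
    proof -
      let ?u = "q (J t \<omega>)"
      have "(\<lambda>j. p t j \<omega> * exp (- (2 * \<gamma>) * oco_excess sg L ustar \<omega> t (q j)))
          sums exp (- (2 * \<gamma>) * oco_excess sg L ustar \<omega> t ?u)"
        using sums_single[of "J t \<omega>" "\<lambda>j. exp (- (2 * \<gamma>) * oco_excess sg L ustar \<omega> t (q j))"]
        by (rule sums_cong[THEN iffD1, rotated]) (simp add: p_def)
      then have sum_eq: "(\<Sum>j. p t j \<omega> * exp (- (2 * \<gamma>) * oco_excess sg L ustar \<omega> t (q j)))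
          = exp (- (2 * \<gamma>) * oco_excess sg L ustar \<omega> t ?u)"
        by (simp add: sums_iff)
      have "oco_excess sg L ustar \<omega> t ?u \<le> d t \<omega> + \<delta> * (1 + 3 * Gb)"
        unfolding oco_excess_def d_def
        by (rule nearby_excess_le_segment_slope[OF adm[OF \<omega>] U(1) W_in[OF \<omega>] U(2) q_in
              diam[OF W_in[OF \<omega>] U(2)] DG Gb \<delta> J[OF \<omega>, unfolded v_def]])
      from mult_left_mono[OF this, of "2 * \<gamma>"] \<gamma>
      have "- (2 * \<gamma>) * d t \<omega> \<le> C * \<delta> + - (2 * \<gamma>) * oco_excess sg L ustar \<omega> t ?u"
        by (simp add: C_def algebra_simps)
      then have "exp (- (2 * \<gamma>) * d t \<omega>) \<le> exp (C * \<delta>) * exp (- (2 * \<gamma>) * oco_excess sg L ustar \<omega> t ?u)"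
        by (simp flip: exp_add)
      also have "\<dots> \<le> \<kappa> * exp (- (2 * \<gamma>) * oco_excess sg L ustar \<omega> t ?u)"
        by (intro mult_right_mono C\<delta>) simp
      finally show ?thesis
        unfolding sum_eq .
    qed
    have regret: "oco_regret W (L \<omega>) T ustar - (K T / (c * \<gamma>) + 2 * K T)
        \<le> (\<Sum>t=1..T. c * \<gamma> * (d t \<omega>)\<^sup>2 - d t \<omega>)" if \<omega>: "\<omega> \<in> space M" for \<omega>
      unfolding c_def
    \<comment> \<open>Here \<open>r\<close> is the true linearized regret, to which the guarantee
      refers; \<open>d\<close> enters only as its measurable lower surrogate.\<close>
    proof (rule second_order_regret_le[OF \<gamma> K,
          where r = "\<lambda>t. (W t (L \<omega>) - ustar) \<bullet> sg (L \<omega> t) (W t (L \<omega>))"])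
      show "oco_regret W (L \<omega>) T ustar \<le> (\<Sum>t=1..T. (W t (L \<omega>) - ustar) \<bullet> sg (L \<omega> t) (W t (L \<omega>)))"
        unfolding oco_regret_def
      proof (rule sum_mono)
        fix t
        from oco_admissible_subgradient[OF adm[OF \<omega>, of t] U(2) W_in[OF \<omega>, of t]]
        show "L \<omega> t (W t (L \<omega>)) - L \<omega> t ustar \<le> (W t (L \<omega>) - ustar) \<bullet> sg (L \<omega> t) (W t (L \<omega>))"
          by (simp add: inner_commute inner_diff_right inner_diff_left)
      qed
    qed (use guarantee[OF \<omega>] d_bounds[OF \<omega>] excess_bound[OF W_in[OF \<omega>] \<omega>] in
        \<open>auto simp: oco_lin_regret_def oco_V_def abs_le_iff\<close>)
    show "\<exists>d :: nat \<Rightarrow> 'a \<Rightarrow> real.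
      (\<forall>t\<ge>1. d t \<in> borel_measurable (?F t) \<and> (\<forall>\<omega>\<in>space M. \<bar>d t \<omega>\<bar> \<le> 1) \<and>
        (\<exists>p q. (\<forall>j. p j \<in> borel_measurable (?F (t - 1)) \<and> q j \<in> U) \<and>
          (\<forall>\<omega>\<in>space M. (\<forall>j. 0 \<le> p j \<omega>) \<and> (\<lambda>j. p j \<omega>) sums 1 \<and>
            exp (- (2 * \<gamma>) * d t \<omega>)
              \<le> \<kappa> * (\<Sum>j::nat. p j \<omega> * exp (- (2 * \<gamma>) * oco_excess sg L ustar \<omega> t (q j)))))) \<and>
      (\<forall>\<omega>\<in>space M. oco_regret W (L \<omega>) T ustar - (K T / (c * \<gamma>) + 2 * K T)
        \<le> (\<Sum>t=1..T. c * \<gamma> * (d t \<omega>)\<^sup>2 - d t \<omega>))"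
    proof (rule exI[of _ d], intro conjI allI impI ballI)
      fix t :: nat assume "1 \<le> t"
      then show "\<exists>p q. (\<forall>j. p j \<in> borel_measurable (?F (t - 1)) \<and> q j \<in> U) \<and>
          (\<forall>\<omega>\<in>space M. (\<forall>j. 0 \<le> p j \<omega>) \<and> (\<lambda>j. p j \<omega>) sums 1 \<and>
            exp (- (2 * \<gamma>) * d t \<omega>)
              \<le> \<kappa> * (\<Sum>j::nat. p j \<omega> * exp (- (2 * \<gamma>) * oco_excess sg L ustar \<omega> t (q j))))"
        by (intro exI[of _ "p t"] exI[of _ q] conjI allI ballI p_F q_in p_sums mixture)
          (auto simp: p_def)
    qed (use d_F d_bounds regret in auto)
  qed
qed

theorem mainTheorem2:
  shows "(\<forall>(M :: 'a measure) L W K kstar. hedge_setting M L W K kstar \<longrightarrow>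
            (\<forall>T::nat. T \<ge> 1 \<longrightarrow> (\<forall>\<gamma>::real. \<gamma> > 0 \<longrightarrow>
              (let c = 1 / (1 + sqrt (1 + 4 * \<gamma>\<^sup>2));
                   \<epsilon> = max_cgf M (hedge_filt M L) UNIV (hedge_excess L kstar)
               in esi M \<gamma> (\<lambda>\<omega>. hedge_regret W (L \<omega>) T kstar)
                    (\<lambda>\<omega>. K T / (c * \<gamma>) + real T * \<epsilon> (2 * \<gamma>) * (1 + c * \<gamma>\<^sup>2) + 2 * K T)))))
       \<and>
       (\<forall>(M :: 'b measure) (U :: (real^'d) set) D Gb sg L W K ustar.
          oco_setting M U D Gb sg L W K ustar \<longrightarrow>
            (\<forall>T::nat. T \<ge> 1 \<longrightarrow> (\<forall>\<gamma>::real. \<gamma> > 0 \<longrightarrow>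
              (let c = 1 / (1 + sqrt (1 + 4 * \<gamma>\<^sup>2));
                   \<epsilon> = max_cgf M (oco_filt M U L) U (oco_excess sg L ustar)
               in esi M \<gamma> (\<lambda>\<omega>. oco_regret W (L \<omega>) T ustar)
                    (\<lambda>\<omega>. K T / (c * \<gamma>) + real T * \<epsilon> (2 * \<gamma>) * (1 + c * \<gamma>\<^sup>2) + 2 * K T)))))"
proof (intro conjI allI impI)
  fix M :: "'a measure" and L W K kstar T and \<gamma> :: real
  assume "hedge_setting M L W K kstar" "0 < \<gamma>"
  from hedge_second_order_esi[OF this, of T]
  show "let c = 1 / (1 + sqrt (1 + 4 * \<gamma>\<^sup>2));
            \<epsilon> = max_cgf M (hedge_filt M L) UNIV (hedge_excess L kstar)
        in esi M \<gamma> (\<lambda>\<omega>. hedge_regret W (L \<omega>) T kstar)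
             (\<lambda>\<omega>. K T / (c * \<gamma>) + real T * \<epsilon> (2 * \<gamma>) * (1 + c * \<gamma>\<^sup>2) + 2 * K T)"
    by (simp only: Let_def ac_simps)
next
  fix M :: "'b measure" and U :: "(real^'d) set" and D Gb sg L W K ustar T and \<gamma> :: real
  assume "oco_setting M U D Gb sg L W K ustar" "0 < \<gamma>"
  from oco_second_order_esi[OF this, of T]
  show "let c = 1 / (1 + sqrt (1 + 4 * \<gamma>\<^sup>2));
            \<epsilon> = max_cgf M (oco_filt M U L) U (oco_excess sg L ustar)
        in esi M \<gamma> (\<lambda>\<omega>. oco_regret W (L \<omega>) T ustar)
             (\<lambda>\<omega>. K T / (c * \<gamma>) + real T * \<epsilon> (2 * \<gamma>) * (1 + c * \<gamma>\<^sup>2) + 2 * K T)"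
    by (simp only: Let_def ac_simps)
qed

end
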